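(* Let $R$ be a ring. (1) Let $P=(V,W)$ be a left $R$-pairing. (a) Let $W'\subseteq W$ be a left $R$-submodule and consider the induced left $R$-pairing $P'=(V,W')$. If $P'$ is a left $\alpha$-pairing, then $W'\subseteq W$ is pure. If $P$ is a left $\alpha$-pairing, then $P'$ is a left $\alpha$-pairing if and only if $W'\subseteq W$ is pure. (b) Let $V'\subseteq V$ be a right $R$-submodule and $W'\subseteq W$ a left $R$-submodule with $\langle V',W'\rangle=0$, and consider the induced left $R$-pairing $Q=(V/V',W')$. If $P$ is a left $\alpha$-pairing, then $Q$ is a left $\alpha$-pairing if and only if $W'\subseteq W$ is pure. In particular, the class of left $\alpha$-pairings is closed under pure left $R$-subpairings. (2) Let $\Omega=(Y,W)$ be a left $R$-pairing, $V$ a right $R$-module, $\xi:V\to Y$ a right $R$-linear map, and let $P=(V,W)$ be the induced left $R$-pairing (with $\kappa_P=\kappa_\Omega\circ\xi$). Consider the statements: (i) $\Omega$ is a left $\alpha$-pairing and $P$ is dense; (ii) $\Omega$ is a left $\alpha$-pairing and $\xi(V)\subseteq Y$ is dense with respect to the linear weak topology $Y[\mathfrak{T}_{ls}^{r}(W)]$; (iii) $P$ is a left $\alpha$-pairing; (iv) $P$ is a left $\alpha$-pairing and $\chi_P:W\to V^{*}$ is injective. Then (i) $\Rightarrow$ (ii) $\Rightarrow$ (iii) $\Rightarrow$ (iv) always hold. If $R_R$ is an injective cogenerator, then (i)–(iv) are equivalent.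
   Context: $R$ is an associative, not necessarily commutative ring with $1_R\neq 0_R$; all modules are unitary. For a left $R$-module $W$, ${}^{*}W$ is the right $R$-module of left $R$-linear maps $W\to R$; for a right $R$-module $V$, $V^{*}$ is the left $R$-module of right $R$-linear maps $V\to R$. A left $R$-pairing $P=(V,W)$ consists of a right $R$-module $V$, a left $R$-module $W$ and a right $R$-linear map $\kappa_P:V\to{}^{*}W$; equivalently a left $R$-linear map $\chi_P:W\to V^{*}$, where $\langle v,w\rangle:=\kappa_P(v)(w)=\chi_P(w)(v)$. $P$ is a left $\alpha$-pairing if for every right $R$-module $M$ the map $$\alpha_M^P:M\otimes_R W\to \mathrm{Hom}_{-R}(V,M),\quad \sum m_i\otimes w_i\mapsto\Big[v\mapsto\sum m_i\langle v,w_i\rangle\Big]$$ is injective, where $\mathrm{Hom}_{-R}$ denotes right $R$-linear maps. If $V'\subseteq V$ is a right submodule and $W'\subseteq W$ is a (pure) left submodule with $\langle V',W'\rangle=0$, then $(V/V',W')$ with $\langle v+V',w'\rangle=\langle v,w'\rangle$ is called a (pure) left $R$-subpairing of $P$. A left $R$-submodule $W'\subseteq W$ is pure if $N\otimes_R W'\to N\otimes_R W$ is injective for every right $R$-module $N$. The finite topology on ${}^{*}W$ has as basis of neighbourhoods of $0$ the submodules $\{f\in{}^{*}W\mid f(F)=0\}$, $F\subseteq W$ finite. $P=(V,W)$ is dense if $\kappa_P(V)\subseteq{}^{*}W$ is dense in the finite topology. The linear weak topology $Y[\mathfrak{T}_{ls}^{r}(W)]$ on $Y$ is the linear topology with basis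 of neighbourhoods of $0$ the submodules $F^{\bot}=\{y\in Y\mid\langle y,w\rangle=0\ \forall w\in F\}$, $F\subseteq W$ finite. *)

theory Defs
  imports "HOL-Algebra.Module" "HOL-Algebra.AbelCoset" "HOL-Algebra.Free_Abelian_Groups" "HOL-Analysis.Abstract_Topology"
begin

section \<open>Modules over a not necessarily commutative ring\<close>

text \<open>
  The locale \<^locale>\<open>module\<close> of the library requires a commutative ring, so one-sided modules are
  introduced here, on the library's record type of modules.  In a right module
  \<open>r \<odot>\<^bsub>M\<^esub> m\<close> stands for the product $m r$.
\<close>

locale left_module = R?: ring R + M?: abelian_group M
  for R :: "('a, 'k) ring_scheme" (structure) and M :: "('a, 'b) module" (structure) +
  assumes smult_closed [simp, intro]:
      "\<lbrakk>a \<in> carrier R; x \<in> carrier M\<rbrakk> \<Longrightarrow> a \<odot>\<^bsub>M\<^esub> x \<in> carrier M"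
    and smult_l_distr:
      "\<lbrakk>a \<in> carrier R; b \<in> carrier R; x \<in> carrier M\<rbrakk> \<Longrightarrow>
        (a \<oplus> b) \<odot>\<^bsub>M\<^esub> x = a \<odot>\<^bsub>M\<^esub> x \<oplus>\<^bsub>M\<^esub> b \<odot>\<^bsub>M\<^esub> x"
    and smult_r_distr:
      "\<lbrakk>a \<in> carrier R; x \<in> carrier M; y \<in> carrier M\<rbrakk> \<Longrightarrow>
        a \<odot>\<^bsub>M\<^esub> (x \<oplus>\<^bsub>M\<^esub> y) = a \<odot>\<^bsub>M\<^esub> x \<oplus>\<^bsub>M\<^esub> a \<odot>\<^bsub>M\<^esub> y"
    and smult_assoc1:
      "\<lbrakk>a \<in> carrier R; b \<in> carrier R; x \<in> carrier M\<rbrakk> \<Longrightarrow>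
        (a \<otimes> b) \<odot>\<^bsub>M\<^esub> x = a \<odot>\<^bsub>M\<^esub> (b \<odot>\<^bsub>M\<^esub> x)"
    and smult_one [simp]: "x \<in> carrier M \<Longrightarrow> \<one> \<odot>\<^bsub>M\<^esub> x = x"

locale right_module = R?: ring R + M?: abelian_group M
  for R :: "('a, 'k) ring_scheme" (structure) and M :: "('a, 'b) module" (structure) +
  assumes smult_closed [simp, intro]:
      "\<lbrakk>a \<in> carrier R; x \<in> carrier M\<rbrakk> \<Longrightarrow> a \<odot>\<^bsub>M\<^esub> x \<in> carrier M"
    and smult_l_distr:
      "\<lbrakk>a \<in> carrier R; b \<in> carrier R; x \<in> carrier M\<rbrakk> \<Longrightarrow>
        (a \<oplus> b) \<odot>\<^bsub>M\<^esub> x = a \<odot>\<^bsub>M\<^esub> x \<oplus>\<^bsub>M\<^esub> b \<odot>\<^bsub>M\<^esub> x"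
    and smult_r_distr:
      "\<lbrakk>a \<in> carrier R; x \<in> carrier M; y \<in> carrier M\<rbrakk> \<Longrightarrow>
        a \<odot>\<^bsub>M\<^esub> (x \<oplus>\<^bsub>M\<^esub> y) = a \<odot>\<^bsub>M\<^esub> x \<oplus>\<^bsub>M\<^esub> a \<odot>\<^bsub>M\<^esub> y"
    and smult_assoc1:
      "\<lbrakk>a \<in> carrier R; b \<in> carrier R; x \<in> carrier M\<rbrakk> \<Longrightarrow>
        (a \<otimes> b) \<odot>\<^bsub>M\<^esub> x = b \<odot>\<^bsub>M\<^esub> (a \<odot>\<^bsub>M\<^esub> x)"
    and smult_one [simp]: "x \<in> carrier M \<Longrightarrow> \<one> \<odot>\<^bsub>M\<^esub> x = x"

text \<open>
  Linearity of a map, being a submodule (\<^const>\<open>submodule\<close> of the library) and the quotient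
  construction do not depend on the side of the modules involved.  Maps are determined by their
  values on the carrier; the maps in \<open>lin_maps\<close> are not required to be extensional.
\<close>

definition lin_maps ::
  "('a, 'k) ring_scheme \<Rightarrow> ('a, 'b) module \<Rightarrow> ('a, 'c) module \<Rightarrow> ('b \<Rightarrow> 'c) set" where
  "lin_maps R M N = {f \<in> carrier M \<rightarrow> carrier N.
     (\<forall>x\<in>carrier M. \<forall>y\<in>carrier M. f (x \<oplus>\<^bsub>M\<^esub> y) = f x \<oplus>\<^bsub>N\<^esub> f y) \<and>
     (\<forall>r\<in>carrier R. \<forall>x\<in>carrier M. f (r \<odot>\<^bsub>M\<^esub> x) = r \<odot>\<^bsub>N\<^esub> f x)}"

text \<open>The fields \<open>mult\<close> and \<open>one\<close> of a module record carry no meaning.\<close>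

definition quot_module :: "('a, 'b) module \<Rightarrow> 'b set \<Rightarrow> ('a, 'b set) module" where
  "quot_module M H = \<lparr>carrier = a_rcosets\<^bsub>M\<^esub> H, monoid.mult = undefined,
     monoid.one = undefined, ring.zero = H, ring.add = set_add M,
     smult = (\<lambda>r C. \<Union>x\<in>C. H +>\<^bsub>M\<^esub> (r \<odot>\<^bsub>M\<^esub> x))\<rparr>"

definition regular_right_module :: "('a, 'k) ring_scheme \<Rightarrow> ('a, 'a) module" where
  "regular_right_module R = \<lparr>carrier = carrier R, monoid.mult = (\<otimes>\<^bsub>R\<^esub>), monoid.one = \<one>\<^bsub>R\<^esub>,
     ring.zero = \<zero>\<^bsub>R\<^esub>, ring.add = (\<oplus>\<^bsub>R\<^esub>), smult = (\<lambda>r x. x \<otimes>\<^bsub>R\<^esub> r)\<rparr>"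

definition regular_left_module :: "('a, 'k) ring_scheme \<Rightarrow> ('a, 'a) module" where
  "regular_left_module R = \<lparr>carrier = carrier R, monoid.mult = (\<otimes>\<^bsub>R\<^esub>), monoid.one = \<one>\<^bsub>R\<^esub>,
     ring.zero = \<zero>\<^bsub>R\<^esub>, ring.add = (\<oplus>\<^bsub>R\<^esub>), smult = (\<lambda>r x. r \<otimes>\<^bsub>R\<^esub> x)\<rparr>"

text \<open>The right module ${}^{*}W$ of a left module $W$, with $(f r)(w) = f(w) r$.\<close>

definition left_dual :: "('a, 'k) ring_scheme \<Rightarrow> ('a, 'w) module \<Rightarrow> ('a, 'w \<Rightarrow> 'a) module" where
  "left_dual R W = \<lparr>carrier = lin_maps R W (regular_left_module R) \<inter> extensional (carrier W),
     monoid.mult = undefined, monoid.one = undefined,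
     ring.zero = (\<lambda>w\<in>carrier W. \<zero>\<^bsub>R\<^esub>), ring.add = (\<lambda>f g. \<lambda>w\<in>carrier W. f w \<oplus>\<^bsub>R\<^esub> g w),
     smult = (\<lambda>r f. \<lambda>w\<in>carrier W. f w \<otimes>\<^bsub>R\<^esub> r)\<rparr>"

text \<open>The left module $V^{*}$ of a right module $V$, with $(r f)(v) = r f(v)$.\<close>

definition right_dual :: "('a, 'k) ring_scheme \<Rightarrow> ('a, 'v) module \<Rightarrow> ('a, 'v \<Rightarrow> 'a) module" where
  "right_dual R V = \<lparr>carrier = lin_maps R V (regular_right_module R) \<inter> extensional (carrier V),
     monoid.mult = undefined, monoid.one = undefined,
     ring.zero = (\<lambda>v\<in>carrier V. \<zero>\<^bsub>R\<^esub>), ring.add = (\<lambda>f g. \<lambda>v\<in>carrier V. f v \<oplus>\<^bsub>R\<^esub> g v),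
     smult = (\<lambda>r f. \<lambda>v\<in>carrier V. r \<otimes>\<^bsub>R\<^esub> f v)\<rparr>"


section \<open>Tensor products\<close>

text \<open>
  For a right module $M$ and a left module $W$, the group $M \otimes_R W$ is the free Abelian group
  on $M \times W$ modulo the subgroup generated by the elements expressing biadditivity and
  $m r \otimes w = m \otimes r w$.
\<close>

definition tensor_relators ::
  "('a, 'k) ring_scheme \<Rightarrow> ('a, 'm) module \<Rightarrow> ('a, 'w) module \<Rightarrow> ('m \<times> 'w \<Rightarrow>\<^sub>0 int) set" where
  "tensor_relators R M W =
     {frag_of (m \<oplus>\<^bsub>M\<^esub> n, w) - frag_of (m, w) - frag_of (n, w) | m n w.
        m \<in> carrier M \<and> n \<in> carrier M \<and> w \<in> carrier W} \<union>
     {frag_of (m, w \<oplus>\<^bsub>W\<^esub> u) - frag_of (m, w) - frag_of (m, u) | m w u.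
        m \<in> carrier M \<and> w \<in> carrier W \<and> u \<in> carrier W} \<union>
     {frag_of (r \<odot>\<^bsub>M\<^esub> m, w) - frag_of (m, r \<odot>\<^bsub>W\<^esub> w) | r m w.
        r \<in> carrier R \<and> m \<in> carrier M \<and> w \<in> carrier W}"

abbreviation tensor_free :: "('a, 'm) module \<Rightarrow> ('a, 'w) module \<Rightarrow> ('m \<times> 'w \<Rightarrow>\<^sub>0 int) monoid" where
  "tensor_free M W \<equiv> free_Abelian_group (carrier M \<times> carrier W)"

definition tensor_kernel ::
  "('a, 'k) ring_scheme \<Rightarrow> ('a, 'm) module \<Rightarrow> ('a, 'w) module \<Rightarrow> ('m \<times> 'w \<Rightarrow>\<^sub>0 int) set" where
  "tensor_kernel R M W = generate (tensor_free M W) (tensor_relators R M W)"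

definition tensor_product ::
  "('a, 'k) ring_scheme \<Rightarrow> ('a, 'm) module \<Rightarrow> ('a, 'w) module \<Rightarrow> ('m \<times> 'w \<Rightarrow>\<^sub>0 int) set monoid"
  where "tensor_product R M W = tensor_free M W Mod tensor_kernel R M W"

definition tensor ::
  "('a, 'k) ring_scheme \<Rightarrow> ('a, 'm) module \<Rightarrow> ('a, 'w) module \<Rightarrow> 'm \<Rightarrow> 'w \<Rightarrow> ('m \<times> 'w \<Rightarrow>\<^sub>0 int) set"
  where "tensor R M W m w = tensor_kernel R M W #>\<^bsub>tensor_free M W\<^esub> frag_of (m, w)"

text \<open>
  The map $M \otimes_R W' \to M \otimes_R W$, $m \otimes w \mapsto m \otimes f(w)$, for $f : W' \to W$;
  as usual for quotient groups, a coset is mapped to the common value of its representatives.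
\<close>

definition tensor_map ::
  "('a, 'k) ring_scheme \<Rightarrow> ('a, 'm) module \<Rightarrow> ('a, 'w) module \<Rightarrow> ('u \<Rightarrow> 'w) \<Rightarrow>
     ('m \<times> 'u \<Rightarrow>\<^sub>0 int) set \<Rightarrow> ('m \<times> 'w \<Rightarrow>\<^sub>0 int) set" where
  "tensor_map R M W f = (\<lambda>T. the_elem
     ((\<lambda>p. tensor_kernel R M W #>\<^bsub>tensor_free M W\<^esub> frag_extend (\<lambda>(m, w). frag_of (m, f w)) p) ` T))"

text \<open>
  Properties required for every right module $M$ are stated for all $M$ whose carrier is a set of
  elements of the type below, which has room for every finitely generated right module.  This
  entails the property for modules on arbitrary types, as shown in \<open>pure_submoduleD\<close> and
  \<open>left_alpha_pairingD\<close>.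
\<close>

type_synonym 'a test = "(nat \<Rightarrow> 'a) set"

definition pure_submodule ::
  "'w set \<Rightarrow> ('a, 'k) ring_scheme \<Rightarrow> ('a, 'w) module \<Rightarrow> bool" where
  "pure_submodule H R W \<longleftrightarrow> submodule H R W \<and>
     (\<forall>N :: ('a, 'a test) module. right_module R N \<longrightarrow>
        inj_on (tensor_map R N W (\<lambda>w. w)) (carrier (tensor_product R N (W\<lparr>carrier := H\<rparr>))))"


section \<open>Pairings\<close>

record ('a, 'v, 'w) pairing =
  rmod :: "('a, 'v) module"
  lmod :: "('a, 'w) module"
  kappa :: "'v \<Rightarrow> 'w \<Rightarrow> 'a"

definition left_pairing :: "('a, 'k) ring_scheme \<Rightarrow> ('a, 'v, 'w) pairing \<Rightarrow> bool" where
  "left_pairing R P \<longleftrightarrow> right_module R (rmod P) \<and> left_module R (lmod P) \<and>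
     kappa P \<in> lin_maps R (rmod P) (left_dual R (lmod P))"

definition chi :: "('a, 'v, 'w) pairing \<Rightarrow> 'w \<Rightarrow> 'v \<Rightarrow> 'a" where
  "chi P w = (\<lambda>v\<in>carrier (rmod P). kappa P v w)"

text \<open>
  \<open>frag_sum G b\<close> maps $\sum_i k_i x_i$ to $\sum_i k_i b(x_i)$, so that \<open>alpha_map\<close> maps
  $\sum_i m_i \otimes w_i$ to $v \mapsto \sum_i m_i \langle v, w_i\rangle$.
\<close>

definition frag_sum :: "('b, 'k) ring_scheme \<Rightarrow> ('c \<Rightarrow> 'b) \<Rightarrow> ('c \<Rightarrow>\<^sub>0 int) \<Rightarrow> 'b" where
  "frag_sum G b p = (\<Oplus>\<^bsub>G\<^esub>x\<in>Poly_Mapping.keys p. [poly_mapping.lookup p x] \<cdot>\<^bsub>G\<^esub> b x)"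

definition alpha_map ::
  "('a, 'v, 'w) pairing \<Rightarrow> ('a, 'm) module \<Rightarrow> ('m \<times> 'w \<Rightarrow>\<^sub>0 int) set \<Rightarrow> 'v \<Rightarrow> 'm" where
  "alpha_map P M = (\<lambda>T. the_elem
     ((\<lambda>p. \<lambda>v\<in>carrier (rmod P). frag_sum M (\<lambda>(m, w). kappa P v w \<odot>\<^bsub>M\<^esub> m) p) ` T))"

definition left_alpha_pairing :: "('a, 'k) ring_scheme \<Rightarrow> ('a, 'v, 'w) pairing \<Rightarrow> bool" where
  "left_alpha_pairing R P \<longleftrightarrow> left_pairing R P \<and>
     (\<forall>M :: ('a, 'a test) module. right_module R M \<longrightarrow>
        inj_on (alpha_map P M) (carrier (tensor_product R M (lmod P))))"

text \<open>The pairings $(V, W')$ and $(V/V', W')$ induced by $P = (V, W)$, and $(V, W)$ induced by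
  $\Omega = (Y, W)$ and $\xi : V \to Y$.\<close>

definition restrict_pairing :: "('a, 'v, 'w) pairing \<Rightarrow> 'w set \<Rightarrow> ('a, 'v, 'w) pairing" where
  "restrict_pairing P W' =
     \<lparr>rmod = rmod P, lmod = (lmod P)\<lparr>carrier := W'\<rparr>, kappa = (\<lambda>v. \<lambda>w\<in>W'. kappa P v w)\<rparr>"

definition subpairing :: "('a, 'v, 'w) pairing \<Rightarrow> 'v set \<Rightarrow> 'w set \<Rightarrow> ('a, 'v set, 'w) pairing" where
  "subpairing P V' W' =
     \<lparr>rmod = quot_module (rmod P) V', lmod = (lmod P)\<lparr>carrier := W'\<rparr>,
      kappa = (\<lambda>C. \<lambda>w\<in>W'. the_elem ((\<lambda>v. kappa P v w) ` C))\<rparr>"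

definition pullback_pairing ::
  "('a, 'y, 'w) pairing \<Rightarrow> ('a, 'v) module \<Rightarrow> ('v \<Rightarrow> 'y) \<Rightarrow> ('a, 'v, 'w) pairing" where
  "pullback_pairing P V xi = \<lparr>rmod = V, lmod = lmod P, kappa = kappa P \<circ> xi\<rparr>"

definition pairing_annihilates ::
  "('a, 'k) ring_scheme \<Rightarrow> ('a, 'v, 'w) pairing \<Rightarrow> 'v set \<Rightarrow> 'w set \<Rightarrow> bool" where
  "pairing_annihilates R P V' W' \<longleftrightarrow> (\<forall>v\<in>V'. \<forall>w\<in>W'. kappa P v w = \<zero>\<^bsub>R\<^esub>)"

definition pure_left_subpairing ::
  "('a, 'k) ring_scheme \<Rightarrow> ('a, 'v set, 'w) pairing \<Rightarrow> ('a, 'v, 'w) pairing \<Rightarrow> bool" where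
  "pure_left_subpairing R Q P \<longleftrightarrow>
     (\<exists>V' W'. submodule V' R (rmod P) \<and> pure_submodule W' R (lmod P) \<and>
        pairing_annihilates R P V' W' \<and> Q = subpairing P V' W')"


section \<open>Linear topologies\<close>

text \<open>
  The topology for which the members of \<open>B\<close> form a basis of neighbourhoods of \<open>0\<close>; it is
  meaningful for a filter base of subgroups, see \<open>openin_linear_topology\<close>.
\<close>

definition linear_topology :: "('a, 'b) module \<Rightarrow> 'b set set \<Rightarrow> 'b topology" where
  "linear_topology M B =
     topology (\<lambda>U. U \<subseteq> carrier M \<and> (\<forall>x\<in>U. \<exists>N\<in>B. N +>\<^bsub>M\<^esub> x \<subseteq> U))"

definition finite_topology ::
  "('a, 'k) ring_scheme \<Rightarrow> ('a, 'w) module \<Rightarrow> ('w \<Rightarrow> 'a) topology" where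
  "finite_topology R W = linear_topology (left_dual R W)
     {{f \<in> carrier (left_dual R W). \<forall>w\<in>F. f w = \<zero>\<^bsub>R\<^esub>} | F. finite F \<and> F \<subseteq> carrier W}"

definition linear_weak_topology ::
  "('a, 'k) ring_scheme \<Rightarrow> ('a, 'y, 'w) pairing \<Rightarrow> 'y topology" where
  "linear_weak_topology R P = linear_topology (rmod P)
     {{y \<in> carrier (rmod P). \<forall>w\<in>F. kappa P y w = \<zero>\<^bsub>R\<^esub>} | F. finite F \<and> F \<subseteq> carrier (lmod P)}"

definition dense_pairing :: "('a, 'k) ring_scheme \<Rightarrow> ('a, 'v, 'w) pairing \<Rightarrow> bool" where
  "dense_pairing R P \<longleftrightarrow>
     finite_topology R (lmod P) closure_of (kappa P ` carrier (rmod P))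
       = carrier (left_dual R (lmod P))"


section \<open>Injective cogenerators\<close>

text \<open>
  Again the modules $A$, $B$ are taken from the type \<^typ>\<open>'a test\<close>.  Both notions are used as
  hypotheses only, and requiring less of the module makes them weaker hypotheses.  For injectivity
  nothing is lost, since testing on right ideals suffices by Baer's criterion.
\<close>

definition injective_right_module :: "('a, 'k) ring_scheme \<Rightarrow> ('a, 'e) module \<Rightarrow> bool" where
  "injective_right_module R E \<longleftrightarrow> right_module R E \<and>
     (\<forall>(A :: ('a, 'a test) module) (B :: ('a, 'a test) module). \<forall>i\<in>lin_maps R A B. \<forall>f\<in>lin_maps R A E.
        right_module R A \<and> right_module R B \<and> inj_on i (carrier A) \<longrightarrow>
        (\<exists>g\<in>lin_maps R B E. \<forall>a\<in>carrier A. g (i a) = f a))"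

text \<open>The functor $\mathrm{Hom}(-, E)$ is faithful.\<close>

definition cogenerator_right_module :: "('a, 'k) ring_scheme \<Rightarrow> ('a, 'e) module \<Rightarrow> bool" where
  "cogenerator_right_module R E \<longleftrightarrow> right_module R E \<and>
     (\<forall>(A :: ('a, 'a test) module) (B :: ('a, 'a test) module). \<forall>f\<in>lin_maps R A B. \<forall>g\<in>lin_maps R A B.
        right_module R A \<and> right_module R B \<and> (\<exists>a\<in>carrier A. f a \<noteq> g a) \<longrightarrow>
        (\<exists>h\<in>lin_maps R B E. \<exists>a\<in>carrier A. h (f a) \<noteq> h (g a)))"


section \<open>Justification of the definitions\<close>

lemma tensor_relatorsI:
  "\<lbrakk>m \<in> carrier M; n \<in> carrier M; w \<in> carrier W\<rbrakk> \<Longrightarrow>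
     frag_of (m \<oplus>\<^bsub>M\<^esub> n, w) - frag_of (m, w) - frag_of (n, w) \<in> tensor_relators R M W"
  "\<lbrakk>m \<in> carrier M; w \<in> carrier W; u \<in> carrier W\<rbrakk> \<Longrightarrow>
     frag_of (m, w \<oplus>\<^bsub>W\<^esub> u) - frag_of (m, w) - frag_of (m, u) \<in> tensor_relators R M W"
  "\<lbrakk>r \<in> carrier R; m \<in> carrier M; w \<in> carrier W\<rbrakk> \<Longrightarrow>
     frag_of (r \<odot>\<^bsub>M\<^esub> m, w) - frag_of (m, r \<odot>\<^bsub>W\<^esub> w) \<in> tensor_relators R M W"
  unfolding tensor_relators_def by blast+

lemma tensor_relatorsE:
  assumes "p \<in> tensor_relators R M W"
  obtains (1) m n w where "p = frag_of (m \<oplus>\<^bsub>M\<^esub> n, w) - frag_of (m, w) - frag_of (n, w)"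
      "m \<in> carrier M" "n \<in> carrier M" "w \<in> carrier W"
    | (2) m w u where "p = frag_of (m, w \<oplus>\<^bsub>W\<^esub> u) - frag_of (m, w) - frag_of (m, u)"
      "m \<in> carrier M" "w \<in> carrier W" "u \<in> carrier W"
    | (3) r m w where "p = frag_of (r \<odot>\<^bsub>M\<^esub> m, w) - frag_of (m, r \<odot>\<^bsub>W\<^esub> w)"
      "r \<in> carrier R" "m \<in> carrier M" "w \<in> carrier W"
  using assms unfolding tensor_relators_def by blast

lemma tensor_relators_subset:
  assumes "right_module R M" "left_module R W"
  shows "tensor_relators R M W \<subseteq> carrier (tensor_free M W)"
proof -
  interpret M: right_module R M by fact
  interpret W: left_module R W by fact
  have keys2: "Poly_Mapping.keys (frag_of x - frag_of y) \<subseteq> {x, y}"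
    for x y :: "'m \<times> 'w"
    using keys_diff[of "frag_of x" "frag_of y"] by (auto simp: keys_frag_of)
  have keys3: "Poly_Mapping.keys (frag_of x - frag_of y - frag_of z) \<subseteq> {x, y, z}"
    for x y z :: "'m \<times> 'w"
    using keys_diff[of "frag_of x - frag_of y" "frag_of z"] keys2[of x y] by (auto simp: keys_frag_of)
  show ?thesis
  proof
    fix p assume "p \<in> tensor_relators R M W"
    then show "p \<in> carrier (tensor_free M W)"
    proof (cases rule: tensor_relatorsE)
      case (1 m n w)
      then show ?thesis using keys3[of "(m \<oplus>\<^bsub>M\<^esub> n, w)" "(m, w)" "(n, w)"] by auto
    next
      case (2 m w u)
      then show ?thesis using keys3[of "(m, w \<oplus>\<^bsub>W\<^esub> u)" "(m, w)" "(m, u)"] by auto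
    next
      case (3 r m w)
      then show ?thesis using keys2[of "(r \<odot>\<^bsub>M\<^esub> m, w)" "(m, r \<odot>\<^bsub>W\<^esub> w)"] by auto
    qed
  qed
qed

lemma tensor_kernel_subgroup:
  assumes "right_module R M" "left_module R W"
  shows "subgroup (tensor_kernel R M W) (tensor_free M W)"
  unfolding tensor_kernel_def
  by (intro group.generate_is_subgroup tensor_relators_subset assms group_free_Abelian_group)

lemma tensor_kernel_keys:
  assumes "right_module R M" "left_module R W" "p \<in> tensor_kernel R M W"
  shows "Poly_Mapping.keys p \<subseteq> carrier M \<times> carrier W"
  using subsetD[OF subgroup.subset[OF tensor_kernel_subgroup[OF assms(1,2)]] assms(3)] by simp

lemma tensor_kernel_zero: "0 \<in> tensor_kernel R M W"
  unfolding tensor_kernel_def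
  using generate.one[of "tensor_free M W"] by simp

lemma tensor_kernel_diff:
  assumes "right_module R M" "left_module R W" "p \<in> tensor_kernel R M W" "q \<in> tensor_kernel R M W"
  shows "p - q \<in> tensor_kernel R M W"
proof -
  note sg = tensor_kernel_subgroup[OF assms(1,2)]
  have "p \<otimes>\<^bsub>tensor_free M W\<^esub> (inv\<^bsub>tensor_free M W\<^esub> q) \<in> tensor_kernel R M W"
    using sg assms by (meson subgroup.m_closed subgroup.m_inv_closed)
  then show ?thesis
    using tensor_kernel_keys[OF assms(1,2,4)] by simp
qed

lemma tensor_kernel_induct [consumes 3, case_names zero rel diff]:
  assumes "right_module R M" "left_module R W" "p \<in> tensor_kernel R M W"
    and zero: "P 0" and rel: "\<And>p. p \<in> tensor_relators R M W \<Longrightarrow> P p"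
    and diff: "\<And>p q. \<lbrakk>p \<in> tensor_kernel R M W; q \<in> tensor_kernel R M W; P p; P q\<rbrakk> \<Longrightarrow> P (p - q)"
  shows "P p"
proof -
  have rk: "h \<in> tensor_kernel R M W" if "h \<in> tensor_relators R M W" for h
    using that unfolding tensor_kernel_def by (rule generate.incl)
  have "p \<in> generate (tensor_free M W) (tensor_relators R M W)"
    using assms(3) unfolding tensor_kernel_def .
  then have "p \<in> tensor_kernel R M W \<and> P p"
  proof induction
    case one
    show ?case using zero tensor_kernel_zero by simp
  next
    case (incl h)
    then show ?case using rel rk by simp
  next
    case (inv h)
    have "Poly_Mapping.keys h \<subseteq> carrier M \<times> carrier W"
      using tensor_kernel_keys[OF assms(1,2) rk[OF inv]] .
    then have "inv\<^bsub>tensor_free M W\<^esub> h = 0 - h" by simp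
    then show ?case
      using diff[OF tensor_kernel_zero rk[OF inv] zero rel[OF inv]]
        tensor_kernel_diff[OF assms(1,2) tensor_kernel_zero rk[OF inv]] by metis
  next
    case (eng h1 h2)
    have 0: "0 - h2 \<in> tensor_kernel R M W" "P (0 - h2)"
      using diff[OF tensor_kernel_zero _ zero] tensor_kernel_diff[OF assms(1,2) tensor_kernel_zero]
        eng by blast+
    have "h1 \<otimes>\<^bsub>tensor_free M W\<^esub> h2 = h1 - (0 - h2)" by simp
    then show ?case
      using diff[of h1 "0 - h2"] tensor_kernel_diff[OF assms(1,2), of h1 "0 - h2"] eng 0 by metis
  qed
  then show ?thesis by blast
qed

lemma tensor_coset: "K #>\<^bsub>tensor_free M W\<^esub> p = (\<lambda>k. k + p) ` K"
  unfolding r_coset_def by auto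

lemma tensor_coset_eq_iff:
  assumes "right_module R M" "left_module R W"
  shows "tensor_kernel R M W #>\<^bsub>tensor_free M W\<^esub> p = tensor_kernel R M W #>\<^bsub>tensor_free M W\<^esub> q
    \<longleftrightarrow> p - q \<in> tensor_kernel R M W" (is "?L \<longleftrightarrow> ?R")
proof
  assume ?L
  moreover have "p \<in> tensor_kernel R M W #>\<^bsub>tensor_free M W\<^esub> p"
    unfolding tensor_coset using tensor_kernel_zero[of R M W] by force
  ultimately obtain k where "k \<in> tensor_kernel R M W" "p = k + q"
    unfolding tensor_coset by auto
  then show ?R by simp
next
  assume R: ?R
  have "k + p - q \<in> tensor_kernel R M W" "k + q - p \<in> tensor_kernel R M W"
    if "k \<in> tensor_kernel R M W" for k
  proof -
    have "0 - (p - q) \<in> tensor_kernel R M W"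
      using tensor_kernel_diff[OF assms tensor_kernel_zero R] .
    then show "k + p - q \<in> tensor_kernel R M W"
      using tensor_kernel_diff[OF assms that, of "0 - (p - q)"] by (simp add: algebra_simps)
    show "k + q - p \<in> tensor_kernel R M W"
      using tensor_kernel_diff[OF assms that R] by (simp add: algebra_simps)
  qed
  then show ?L
    unfolding tensor_coset
    apply auto
     apply (rule_tac x="k + p - q" in image_eqI; simp)
    apply (rule_tac x="k + q - p" in image_eqI; simp)
    done
qed

lemma carrier_tensor_product:
  "carrier (tensor_product R M W) =
     {tensor_kernel R M W #>\<^bsub>tensor_free M W\<^esub> p | p. Poly_Mapping.keys p \<subseteq> carrier M \<times> carrier W}"
  unfolding tensor_product_def FactGroup_def RCOSETS_def by auto

lemma lin_maps_compose:
  "\<lbrakk>f \<in> lin_maps R M N; g \<in> lin_maps R N L\<rbrakk> \<Longrightarrow> g \<circ> f \<in> lin_maps R M L"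
  unfolding lin_maps_def by (auto simp: Pi_iff)

lemma lin_maps_closed: "\<lbrakk>f \<in> lin_maps R M N; x \<in> carrier M\<rbrakk> \<Longrightarrow> f x \<in> carrier N"
  unfolding lin_maps_def by auto

text \<open>Functoriality of the tensor product, on representatives.\<close>

lemma tensor_kernel_push:
  assumes M: "right_module R M" "left_module R W" and N: "right_module R N" "left_module R U"
    and f: "f \<in> lin_maps R M N" and g: "g \<in> lin_maps R W U"
    and p: "p \<in> tensor_kernel R M W"
  shows "frag_extend (\<lambda>(m, w). frag_of (f m, g w)) p \<in> tensor_kernel R N U"
  using M p
proof (induction rule: tensor_kernel_induct)
  case zero
  then show ?case by (simp add: tensor_kernel_zero)
next
  case (rel p)
  from rel have "frag_extend (\<lambda>(m, w). frag_of (f m, g w)) p \<in> tensor_relators R N U"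
  proof (cases rule: tensor_relatorsE)
    case (1 m n w)
    then show ?thesis using f g
      by (auto simp: frag_extend_diff lin_maps_def Pi_iff intro!: tensor_relatorsI(1))
  next
    case (2 m w u)
    then show ?thesis using f g
      by (auto simp: frag_extend_diff lin_maps_def Pi_iff intro!: tensor_relatorsI(2))
  next
    case (3 r m w)
    then show ?thesis using f g
      by (auto simp: frag_extend_diff lin_maps_def Pi_iff intro!: tensor_relatorsI(3))
  qed
  then show ?case unfolding tensor_kernel_def by (rule generate.incl)
next
  case (diff p q)
  then show ?case by (simp add: frag_extend_diff tensor_kernel_diff[OF N])
qed

lemma submodule_right_module:
  assumes "right_module R M" "submodule H R M"
  shows "right_module R (M\<lparr>carrier := H\<rparr>)"
proof -
  interpret M: right_module R M by fact
  interpret H: submodule H R M by fact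
  have HM: "x \<in> carrier M" if "x \<in> H" for x using H.subset that by auto
  have "abelian_monoid (M\<lparr>carrier := H\<rparr>)"
    using comm_monoid.submonoid_is_comm_monoid[OF M.a_comm_monoid
        subgroup.subgroup_is_submonoid[OF H.subgroup_axioms]]
    unfolding abelian_monoid_def by auto
  moreover have "abelian_group_axioms (M\<lparr>carrier := H\<rparr>)"
    using H.subgroup_is_group[OF M.a_group] calculation
    unfolding abelian_group_axioms_def comm_group_def abelian_monoid_def by auto
  ultimately show ?thesis
    by (intro right_module.intro abelian_group.intro right_module_axioms.intro M.R.ring_axioms)
      (auto simp: HM M.smult_l_distr M.smult_r_distr M.smult_assoc1 M.R.ring_axioms)
qed

lemma submodule_left_module:
  assumes "left_module R M" "submodule H R M"
  shows "left_module R (M\<lparr>carrier := H\<rparr>)"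
proof -
  interpret M: left_module R M by fact
  interpret H: submodule H R M by fact
  have HM: "x \<in> carrier M" if "x \<in> H" for x using H.subset that by auto
  have "abelian_monoid (M\<lparr>carrier := H\<rparr>)"
    using comm_monoid.submonoid_is_comm_monoid[OF M.a_comm_monoid
        subgroup.subgroup_is_submonoid[OF H.subgroup_axioms]]
    unfolding abelian_monoid_def by auto
  moreover have "abelian_group_axioms (M\<lparr>carrier := H\<rparr>)"
    using H.subgroup_is_group[OF M.a_group] calculation
    unfolding abelian_group_axioms_def comm_group_def abelian_monoid_def by auto
  ultimately show ?thesis
    by (intro left_module.intro abelian_group.intro left_module_axioms.intro M.R.ring_axioms)
      (auto simp: HM M.smult_l_distr M.smult_r_distr M.smult_assoc1 M.R.ring_axioms)
qed

lemma submodule_subset: "submodule H R M \<Longrightarrow> H \<subseteq> carrier M"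
  by (simp add: submodule_def subgroup.subset[of H "add_monoid M", simplified])

lemma id_lin_maps: "H \<subseteq> carrier M \<Longrightarrow> (\<lambda>x. x) \<in> lin_maps R (M\<lparr>carrier := H\<rparr>) M"
  unfolding lin_maps_def by auto

lemma id_lin_maps': "(\<lambda>x. x) \<in> lin_maps R M M"
  unfolding lin_maps_def by auto

text \<open>Elements of the kernel are witnessed by finitely many elements of $M$.\<close>

lemma tensor_kernel_finite:
  assumes M: "right_module R M" "left_module R W" and p: "p \<in> tensor_kernel R M W"
  shows "\<exists>F. finite F \<and> F \<subseteq> carrier M \<and>
    (\<forall>N. submodule N R M \<and> F \<subseteq> N \<longrightarrow> p \<in> tensor_kernel R (M\<lparr>carrier := N\<rparr>) W)"
  using M p
proof (induction rule: tensor_kernel_induct)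
  case zero
  show ?case by (intro exI[of _ "{}"]) (simp add: tensor_kernel_zero)
next
  case (rel p)
  have "\<exists>F. finite F \<and> F \<subseteq> carrier M \<and>
    (\<forall>N. F \<subseteq> N \<longrightarrow> p \<in> tensor_relators R (M\<lparr>carrier := N\<rparr>) W)"
  proof -
    from rel show ?thesis
    proof (cases rule: tensor_relatorsE)
      case (1 m n w)
      then have "p \<in> tensor_relators R (M\<lparr>carrier := N\<rparr>) W" if "{m, n} \<subseteq> N" for N
        using tensor_relatorsI(1)[of m "M\<lparr>carrier := N\<rparr>" n w W R] that by simp
      then show ?thesis using 1(2,3) by (intro exI[of _ "{m, n}"]) simp
    next
      case (2 m w u)
      then have "p \<in> tensor_relators R (M\<lparr>carrier := N\<rparr>) W" if "{m} \<subseteq> N" for N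
        using tensor_relatorsI(2)[of m "M\<lparr>carrier := N\<rparr>" w W u R] that by simp
      then show ?thesis using 2(2,3) by (intro exI[of _ "{m}"]) simp
    next
      case (3 r m w)
      then have "p \<in> tensor_relators R (M\<lparr>carrier := N\<rparr>) W" if "{m} \<subseteq> N" for N
        using tensor_relatorsI(3)[of r R m "M\<lparr>carrier := N\<rparr>" w W] that by simp
      then show ?thesis using 3(2,3) by (intro exI[of _ "{m}"]) simp
    qed
  qed
  then obtain F where F: "finite F" "F \<subseteq> carrier M"
    "\<And>N. F \<subseteq> N \<Longrightarrow> p \<in> tensor_relators R (M\<lparr>carrier := N\<rparr>) W" by blast
  then show ?case unfolding tensor_kernel_def by (intro exI[of _ F]) (simp add: generate.incl)
next
  case (diff p q)
  from diff(3) obtain F where "finite F" "F \<subseteq> carrier M"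
    and F: "\<And>N. submodule N R M \<Longrightarrow> F \<subseteq> N \<Longrightarrow> p \<in> tensor_kernel R (M\<lparr>carrier := N\<rparr>) W"
    by blast
  from diff(4) obtain G where "finite G" "G \<subseteq> carrier M"
    and G: "\<And>N. submodule N R M \<Longrightarrow> G \<subseteq> N \<Longrightarrow> q \<in> tensor_kernel R (M\<lparr>carrier := N\<rparr>) W"
    by blast
  have "p - q \<in> tensor_kernel R (M\<lparr>carrier := N\<rparr>) W" if "submodule N R M" "F \<union> G \<subseteq> N" for N
    using tensor_kernel_diff[OF submodule_right_module[OF M(1) that(1)] M(2) F G] that by simp
  then show ?case
    using \<open>finite F\<close> \<open>finite G\<close> \<open>F \<subseteq> carrier M\<close> \<open>G \<subseteq> carrier M\<close> by (intro exI[of _ "F \<union> G"]) simp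
qed

text \<open>Finitely generated right modules fit into the type \<^typ>\<open>'a test\<close>.\<close>

lemma (in right_module) smult_l_null: "x \<in> carrier M \<Longrightarrow> \<zero> \<odot>\<^bsub>M\<^esub> x = \<zero>\<^bsub>M\<^esub>"
  using smult_l_distr[of \<zero> \<zero> x] M.add.r_cancel_one'[of "\<zero> \<odot>\<^bsub>M\<^esub> x" "\<zero> \<odot>\<^bsub>M\<^esub> x"] by auto

lemma (in right_module) smult_r_null: "a \<in> carrier R \<Longrightarrow> a \<odot>\<^bsub>M\<^esub> \<zero>\<^bsub>M\<^esub> = \<zero>\<^bsub>M\<^esub>"
  using smult_r_distr[of a "\<zero>\<^bsub>M\<^esub>" "\<zero>\<^bsub>M\<^esub>"] M.add.r_cancel_one'[of "a \<odot>\<^bsub>M\<^esub> \<zero>\<^bsub>M\<^esub>" "a \<odot>\<^bsub>M\<^esub> \<zero>\<^bsub>M\<^esub>"] by auto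

lemma (in right_module) smult_l_minus:
  assumes "a \<in> carrier R" "x \<in> carrier M"
  shows "(\<ominus> a) \<odot>\<^bsub>M\<^esub> x = \<ominus>\<^bsub>M\<^esub> (a \<odot>\<^bsub>M\<^esub> x)"
proof -
  have "(\<ominus> a) \<odot>\<^bsub>M\<^esub> x \<oplus>\<^bsub>M\<^esub> a \<odot>\<^bsub>M\<^esub> x = \<zero>\<^bsub>M\<^esub>"
    using smult_l_distr[of "\<ominus> a" a x] assms by (simp add: R.l_neg smult_l_null)
  then show ?thesis using assms by (simp add: M.minus_equality)
qed

lemma (in right_module) submoduleI:
  assumes "H \<subseteq> carrier M" "\<zero>\<^bsub>M\<^esub> \<in> H" "\<And>x y. \<lbrakk>x \<in> H; y \<in> H\<rbrakk> \<Longrightarrow> x \<oplus>\<^bsub>M\<^esub> y \<in> H"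
    "\<And>a x. \<lbrakk>a \<in> carrier R; x \<in> H\<rbrakk> \<Longrightarrow> a \<odot>\<^bsub>M\<^esub> x \<in> H"
  shows "submodule H R M"
proof -
  have "\<ominus>\<^bsub>M\<^esub> x \<in> H" if "x \<in> H" for x
  proof -
    have "(\<ominus> \<one>) \<odot>\<^bsub>M\<^esub> x = \<ominus>\<^bsub>M\<^esub> x"
      using that assms(1) smult_l_minus[of \<one> x] by (auto simp: subset_iff)
    then show ?thesis using assms(4)[of "\<ominus> \<one>" x] that by simp
  qed
  then show ?thesis
    using assms by (intro submodule.intro subgroup.intro submodule_axioms.intro) (auto simp: a_inv_def)
qed

lemma (in right_module) finite_submodule:
  assumes "finite F" "F \<subseteq> carrier M"
  shows "\<exists>H (s :: (nat \<Rightarrow> 'a) \<Rightarrow> 'b). submodule H R M \<and> F \<subseteq> H \<and> H \<subseteq> range s"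
  using assms
proof (induction F)
  case empty
  have "submodule {\<zero>\<^bsub>M\<^esub>} R M" by (rule submoduleI) (auto simp: smult_r_null)
  then show ?case by (intro exI[of _ "{\<zero>\<^bsub>M\<^esub>}"] exI[of _ "\<lambda>_. \<zero>\<^bsub>M\<^esub>"]) auto
next
  case (insert g F)
  then obtain H and s :: "(nat \<Rightarrow> 'a) \<Rightarrow> 'b"
    where H: "submodule H R M" "F \<subseteq> H" "H \<subseteq> range s" by auto
  interpret H: submodule H R M by fact
  have g: "g \<in> carrier M" using insert by auto
  have HM: "x \<in> carrier M" if "x \<in> H" for x using H.subset that by auto
  have H0: "\<zero>\<^bsub>M\<^esub> \<in> H" using H.one_closed by simp
  have Hadd: "x \<oplus>\<^bsub>M\<^esub> y \<in> H" if "x \<in> H" "y \<in> H" for x y using H.m_closed that by simp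
  define K where "K = {x \<oplus>\<^bsub>M\<^esub> r \<odot>\<^bsub>M\<^esub> g | x r. x \<in> H \<and> r \<in> carrier R}"
  define t where "t = (\<lambda>c :: nat \<Rightarrow> 'a. s (\<lambda>i. c (Suc i)) \<oplus>\<^bsub>M\<^esub> c 0 \<odot>\<^bsub>M\<^esub> g)"
  have KI: "y \<in> K" if "y = x \<oplus>\<^bsub>M\<^esub> r \<odot>\<^bsub>M\<^esub> g" "x \<in> H" "r \<in> carrier R" for x y r
    using that unfolding K_def by blast
  have "submodule K R M"
  proof (rule submoduleI)
    show "K \<subseteq> carrier M" unfolding K_def using g HM by auto
    show "\<zero>\<^bsub>M\<^esub> \<in> K" by (rule KI[of _ "\<zero>\<^bsub>M\<^esub>" \<zero>]) (auto simp: H0 g smult_l_null)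
    fix x y assume "x \<in> K" "y \<in> K"
    then obtain x' r y' q where "x = x' \<oplus>\<^bsub>M\<^esub> r \<odot>\<^bsub>M\<^esub> g" "x' \<in> H" "r \<in> carrier R"
      "y = y' \<oplus>\<^bsub>M\<^esub> q \<odot>\<^bsub>M\<^esub> g" "y' \<in> H" "q \<in> carrier R" unfolding K_def by blast
    then show "x \<oplus>\<^bsub>M\<^esub> y \<in> K"
      by (intro KI[of _ "x' \<oplus>\<^bsub>M\<^esub> y'" "r \<oplus> q"]) (auto simp: Hadd g HM smult_l_distr M.a_ac)
  next
    fix a x assume "a \<in> carrier R" "x \<in> K"
    then obtain x' r where "x = x' \<oplus>\<^bsub>M\<^esub> r \<odot>\<^bsub>M\<^esub> g" "x' \<in> H" "r \<in> carrier R"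
      unfolding K_def by blast
    then show "a \<odot>\<^bsub>M\<^esub> x \<in> K" using \<open>a \<in> carrier R\<close>
      by (intro KI[of _ "a \<odot>\<^bsub>M\<^esub> x'" "r \<otimes> a"]) (auto simp: g HM smult_r_distr smult_assoc1)
  qed
  moreover have "x \<in> K" if "x \<in> H" for x
    by (rule KI[of _ x \<zero>]) (auto simp: that g smult_l_null HM)
  moreover have "g \<in> K"
    by (rule KI[of _ "\<zero>\<^bsub>M\<^esub>" \<one>]) (auto simp: H0 g)
  moreover have "K \<subseteq> range t"
  proof
    fix y assume "y \<in> K"
    then obtain x r where "y = x \<oplus>\<^bsub>M\<^esub> r \<odot>\<^bsub>M\<^esub> g" "x \<in> H" "r \<in> carrier R"
      unfolding K_def by blast
    moreover obtain c where "x = s c" using H(3) \<open>x \<in> H\<close> by auto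
    ultimately have "y = t (case_nat r c)" unfolding t_def by simp
    then show "y \<in> range t" by simp
  qed
  ultimately show ?case using H(2) by (intro exI[of _ K] exI[of _ t]) auto
qed

lemma right_module_transport:
  fixes N :: "('a, 'b) module" and phi :: "'b \<Rightarrow> 'c"
  assumes "right_module R N" "inj_on phi (carrier N)"
  obtains L :: "('a, 'c) module" and psi where "right_module R L" "phi \<in> lin_maps R N L"
    "psi \<in> lin_maps R L N" "\<And>x. x \<in> carrier N \<Longrightarrow> psi (phi x) = x"
proof -
  interpret N: right_module R N by fact
  define psi where "psi = inv_into (carrier N) phi"
  define L :: "('a, 'c) module" where
    "L = \<lparr>carrier = phi ` carrier N, monoid.mult = undefined, monoid.one = undefined,
       ring.zero = phi \<zero>\<^bsub>N\<^esub>, ring.add = (\<lambda>x y. phi (psi x \<oplus>\<^bsub>N\<^esub> psi y)),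
       smult = (\<lambda>r x. phi (r \<odot>\<^bsub>N\<^esub> psi x))\<rparr>"
  have psi [simp]: "psi (phi x) = x" if "x \<in> carrier N" for x
    using assms(2) that unfolding psi_def by simp
  have "abelian_group L"
  proof (rule abelian_groupI)
    fix x assume "x \<in> carrier L"
    then obtain a where a: "a \<in> carrier N" "x = phi a" unfolding L_def by auto
    then show "\<exists>y\<in>carrier L. y \<oplus>\<^bsub>L\<^esub> x = \<zero>\<^bsub>L\<^esub>"
      by (intro bexI[of _ "phi (\<ominus>\<^bsub>N\<^esub> a)"]) (auto simp: L_def N.M.l_neg)
  qed (auto simp: L_def N.M.a_ac)
  then have "right_module R L"
    by (intro right_module.intro right_module_axioms.intro N.R.ring_axioms)
      (auto simp: L_def N.smult_l_distr N.smult_r_distr N.smult_assoc1 N.R.ring_axioms)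
  moreover have "phi \<in> lin_maps R N L" "psi \<in> lin_maps R L N"
    unfolding lin_maps_def L_def by auto
  ultimately show ?thesis using that psi by blast
qed

lemma test_module:
  fixes M :: "('a, 'm) module"
  assumes M: "right_module R M" and F: "finite F" "F \<subseteq> carrier M"
  obtains N and L :: "('a, 'a test) module" and phi psi where "submodule N R M" "F \<subseteq> N"
    "right_module R L" "phi \<in> lin_maps R (M\<lparr>carrier := N\<rparr>) L" "psi \<in> lin_maps R L (M\<lparr>carrier := N\<rparr>)"
    "\<And>x. x \<in> N \<Longrightarrow> psi (phi x) = x"
proof -
  obtain N and s :: "(nat \<Rightarrow> 'a) \<Rightarrow> 'm" where N: "submodule N R M" "F \<subseteq> N" "N \<subseteq> range s"
    using right_module.finite_submodule[OF M F] by blast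
  let ?phi = "\<lambda>x. {c. s c = x}"
  have "inj_on ?phi (carrier (M\<lparr>carrier := N\<rparr>))"
    using N(3) by (intro inj_onI) auto
  from right_module_transport[OF submodule_right_module[OF M N(1)] this]
  obtain L :: "('a, 'a test) module" and psi where "right_module R L"
    "?phi \<in> lin_maps R (M\<lparr>carrier := N\<rparr>) L" "psi \<in> lin_maps R L (M\<lparr>carrier := N\<rparr>)"
    "\<And>x. x \<in> carrier (M\<lparr>carrier := N\<rparr>) \<Longrightarrow> psi (?phi x) = x" by blast
  then show ?thesis using N(1,2) that[of N L ?phi psi] by simp
qed

lemma frag_extend_inverse:
  assumes "Poly_Mapping.keys p \<subseteq> S" "\<And>m w. (m, w) \<in> S \<Longrightarrow> psi (phi m) = m"
  shows "frag_extend (\<lambda>(m, w). frag_of (psi m, w)) (frag_extend (\<lambda>(m, w). frag_of (phi m, w)) p) = p"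
  using assms(1)
  by (induction p rule: frag_induction) (auto simp: frag_extend_diff assms(2))

lemma keys_push:
  assumes "Poly_Mapping.keys p \<subseteq> A \<times> B" "f ` A \<subseteq> C" "g ` B \<subseteq> D"
  shows "Poly_Mapping.keys (frag_extend (\<lambda>(m, w). frag_of (f m, g w)) p) \<subseteq> C \<times> D"
proof -
  have "Poly_Mapping.keys (frag_extend (\<lambda>(m, w). frag_of (f m, g w)) p)
    \<subseteq> (\<Union>x\<in>Poly_Mapping.keys p. Poly_Mapping.keys (case x of (m, w) \<Rightarrow> frag_of (f m, g w)))"
    by (rule keys_frag_extend)
  also have "\<dots> \<subseteq> C \<times> D"
    using assms by (fastforce simp: keys_frag_of split: prod.splits)
  finally show ?thesis .
qed

lemma frag_extend_id: "frag_extend (\<lambda>(m, w). frag_of (m, w)) p = p"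
  using frag_expansion[of p] by (simp add: case_prod_beta')

lemma inj_on_tensor_map_iff:
  assumes N: "right_module R N" and W: "left_module R W" and H: "submodule H R W"
  shows "inj_on (tensor_map R N W (\<lambda>w. w)) (carrier (tensor_product R N (W\<lparr>carrier := H\<rparr>))) \<longleftrightarrow>
    (\<forall>p. Poly_Mapping.keys p \<subseteq> carrier N \<times> H \<and> p \<in> tensor_kernel R N W \<longrightarrow>
       p \<in> tensor_kernel R N (W\<lparr>carrier := H\<rparr>))" (is "inj_on ?t ?C \<longleftrightarrow> ?R")
proof -
  let ?W = "W\<lparr>carrier := H\<rparr>"
  let ?K = "tensor_kernel R N ?W" and ?L = "tensor_kernel R N W"
  note W' = submodule_left_module[OF W H]
  have sub: "k \<in> ?L" if "k \<in> ?K" for k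
    using tensor_kernel_push[OF N W' N W id_lin_maps' id_lin_maps[OF submodule_subset[OF H]] that]
    by (simp add: frag_extend_id)
  have t: "?t (?K #>\<^bsub>tensor_free N ?W\<^esub> p) = ?L #>\<^bsub>tensor_free N W\<^esub> p" for p
  proof -
    have "(\<lambda>q. ?L #>\<^bsub>tensor_free N W\<^esub> q) ` (?K #>\<^bsub>tensor_free N ?W\<^esub> p) = {?L #>\<^bsub>tensor_free N W\<^esub> p}"
    proof -
      have "?L #>\<^bsub>tensor_free N W\<^esub> (k + p) = ?L #>\<^bsub>tensor_free N W\<^esub> p" if "k \<in> ?K" for k
        using tensor_coset_eq_iff[OF N W, of "k + p" p] sub[OF that] by simp
      then show ?thesis
        unfolding tensor_coset[where K = ?K] using tensor_kernel_zero[of R N ?W] by (force simp: image_iff)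
    qed
    then show ?thesis unfolding tensor_map_def by (simp add: frag_extend_id)
  qed
  show ?thesis
  proof
    assume inj: "inj_on ?t ?C"
    show ?R
    proof (intro allI impI, elim conjE)
      fix p assume p: "Poly_Mapping.keys p \<subseteq> carrier N \<times> H" "p \<in> ?L"
      have "?t (?K #>\<^bsub>tensor_free N ?W\<^esub> p) = ?t (?K #>\<^bsub>tensor_free N ?W\<^esub> 0)"
        unfolding t using p tensor_coset_eq_iff[OF N W, of p 0] by simp
      then have "?K #>\<^bsub>tensor_free N ?W\<^esub> p = ?K #>\<^bsub>tensor_free N ?W\<^esub> 0"
        by (rule inj_onD[OF inj]) (use p in \<open>auto simp: carrier_tensor_product intro: exI[of _ 0]\<close>)
      then show "p \<in> ?K" using tensor_coset_eq_iff[OF N W', of p 0] by simp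
    qed
  next
    assume R: ?R
    show "inj_on ?t ?C"
    proof (rule inj_onI)
      fix S T assume "S \<in> ?C" "T \<in> ?C" and eq: "?t S = ?t T"
      then obtain p q where pq: "S = ?K #>\<^bsub>tensor_free N ?W\<^esub> p" "T = ?K #>\<^bsub>tensor_free N ?W\<^esub> q"
        "Poly_Mapping.keys p \<subseteq> carrier N \<times> H" "Poly_Mapping.keys q \<subseteq> carrier N \<times> H"
        unfolding carrier_tensor_product by auto
      have "p - q \<in> ?L" using eq unfolding pq t tensor_coset_eq_iff[OF N W] .
      moreover have "Poly_Mapping.keys (p - q) \<subseteq> carrier N \<times> H"
        using keys_diff[of p q] pq by blast
      ultimately show "S = T" unfolding pq tensor_coset_eq_iff[OF N W'] using R by blast
    qed
  qed
qed

lemma pure_submoduleD: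
  fixes N :: "('a, 'n) module"
  assumes pure: "pure_submodule H R W" and N: "right_module R N" and W: "left_module R W"
  shows "inj_on (tensor_map R N W (\<lambda>w. w)) (carrier (tensor_product R N (W\<lparr>carrier := H\<rparr>)))"
proof -
  have H: "submodule H R W" using pure unfolding pure_submodule_def by blast
  note W' = submodule_left_module[OF W H]
  show ?thesis
    unfolding inj_on_tensor_map_iff[OF N W H]
  proof (intro allI impI, elim conjE)
    fix p assume p: "Poly_Mapping.keys p \<subseteq> carrier N \<times> H" "p \<in> tensor_kernel R N W"
    obtain F where F: "finite F" "F \<subseteq> carrier N"
      "\<And>Q. submodule Q R N \<Longrightarrow> F \<subseteq> Q \<Longrightarrow> p \<in> tensor_kernel R (N\<lparr>carrier := Q\<rparr>) W"
      using tensor_kernel_finite[OF N W p(2)] by blast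
    have "finite (F \<union> fst ` Poly_Mapping.keys p)" "F \<union> fst ` Poly_Mapping.keys p \<subseteq> carrier N"
      using F p by auto
    then obtain Q and L :: "('a, 'a test) module" and phi psi where Q: "submodule Q R N"
      "F \<union> fst ` Poly_Mapping.keys p \<subseteq> Q" and L: "right_module R L"
      and phi: "phi \<in> lin_maps R (N\<lparr>carrier := Q\<rparr>) L" and psi: "psi \<in> lin_maps R L (N\<lparr>carrier := Q\<rparr>)"
      and inverse: "\<And>x. x \<in> Q \<Longrightarrow> psi (phi x) = x"
      using test_module[OF N] by metis
    note NQ = submodule_right_module[OF N Q(1)]
    let ?p = "frag_extend (\<lambda>(m, w). frag_of (phi m, w)) p"
    have keys: "Poly_Mapping.keys p \<subseteq> Q \<times> H" using Q p by force
    have "?p \<in> tensor_kernel R L W"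
      using tensor_kernel_push[OF NQ W L W phi id_lin_maps'] F(3) Q by auto
    moreover have "Poly_Mapping.keys ?p \<subseteq> carrier L \<times> H"
      using keys_push[OF keys, of phi "carrier L" "\<lambda>w. w" H] lin_maps_closed[OF phi] by auto
    ultimately have "?p \<in> tensor_kernel R L (W\<lparr>carrier := H\<rparr>)"
      using pure L inj_on_tensor_map_iff[OF L W H] unfolding pure_submodule_def by blast
    from tensor_kernel_push[OF L W' N W' lin_maps_compose[OF psi id_lin_maps[OF submodule_subset[OF Q(1)]]]
        id_lin_maps' this]
    show "p \<in> tensor_kernel R N (W\<lparr>carrier := H\<rparr>)"
      using frag_extend_inverse[OF keys, of psi phi] inverse by (simp add: comp_def)
  qed
qed

lemma (in abelian_group) frag_sum_superset:
  assumes "finite A" "Poly_Mapping.keys p \<subseteq> A" "\<And>x. x \<in> A \<Longrightarrow> b x \<in> carrier G"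
  shows "frag_sum G b p = (\<Oplus>x\<in>A. [poly_mapping.lookup p x] \<cdot> b x)"
proof -
  have "[(0::int)] \<cdot> x = \<zero>" for x by (simp add: add_pow_def int_pow_def2)
  then show ?thesis
    unfolding frag_sum_def using assms
    by (intro add.finprod_mono_neutral_cong_left) (auto simp: in_keys_iff)
qed

lemma (in abelian_group) frag_sum_closed:
  assumes "Poly_Mapping.keys p \<subseteq> S" "\<And>x. x \<in> S \<Longrightarrow> b x \<in> carrier G"
  shows "frag_sum G b p \<in> carrier G"
  unfolding frag_sum_def using assms
  by (intro finsum_closed) (auto intro: add.int_pow_closed)

lemma (in abelian_group) frag_sum_of:
  "b x \<in> carrier G \<Longrightarrow> frag_sum G b (frag_of x) = b x"
  unfolding frag_sum_def by (simp add: keys_frag_of)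

lemma (in abelian_group) frag_sum_0: "frag_sum G b 0 = \<zero>"
  unfolding frag_sum_def by simp

lemma (in abelian_group) frag_sum_add:
  assumes "Poly_Mapping.keys p \<subseteq> S" "Poly_Mapping.keys q \<subseteq> S" "\<And>x. x \<in> S \<Longrightarrow> b x \<in> carrier G"
  shows "frag_sum G b (p + q) = frag_sum G b p \<oplus> frag_sum G b q"
proof -
  let ?A = "Poly_Mapping.keys p \<union> Poly_Mapping.keys q"
  have b: "\<And>x. x \<in> ?A \<Longrightarrow> b x \<in> carrier G" using assms by auto
  have "frag_sum G b (p + q) = (\<Oplus>x\<in>?A. [poly_mapping.lookup (p + q) x] \<cdot> b x)"
    by (rule frag_sum_superset) (use keys_add[of p q] b in auto)
  also have "\<dots> = (\<Oplus>x\<in>?A. [poly_mapping.lookup p x] \<cdot> b x \<oplus> [poly_mapping.lookup q x] \<cdot> b x)"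
    by (rule finsum_cong') (use b in \<open>auto simp: lookup_add add.int_pow_mult intro: add.int_pow_closed\<close>)
  also have "\<dots> = (\<Oplus>x\<in>?A. [poly_mapping.lookup p x] \<cdot> b x) \<oplus> (\<Oplus>x\<in>?A. [poly_mapping.lookup q x] \<cdot> b x)"
    by (rule finsum_addf) (use b in \<open>auto intro: add.int_pow_closed\<close>)
  also have "\<dots> = frag_sum G b p \<oplus> frag_sum G b q"
    using frag_sum_superset[of ?A p b] frag_sum_superset[of ?A q b] b by auto
  finally show ?thesis .
qed

lemma (in abelian_group) frag_sum_diff:
  assumes "Poly_Mapping.keys p \<subseteq> S" "Poly_Mapping.keys q \<subseteq> S" "\<And>x. x \<in> S \<Longrightarrow> b x \<in> carrier G"
  shows "frag_sum G b (p - q) = frag_sum G b p \<ominus> frag_sum G b q"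
proof -
  have k: "Poly_Mapping.keys (p - q) \<subseteq> S" using keys_diff[of p q] assms by blast
  have "frag_sum G b p = frag_sum G b (p - q) \<oplus> frag_sum G b q"
    using frag_sum_add[OF k assms(2,3)] by simp
  moreover have "frag_sum G b (p - q) \<in> carrier G" "frag_sum G b q \<in> carrier G"
    using frag_sum_closed k assms by blast+
  ultimately show ?thesis by (simp add: minus_eq a_assoc r_neg)
qed

lemma frag_sum_push:
  assumes "abelian_group G" "abelian_group H"
    and h: "h \<in> carrier G \<rightarrow> carrier H"
      "\<And>x y. \<lbrakk>x \<in> carrier G; y \<in> carrier G\<rbrakk> \<Longrightarrow> h (x \<oplus>\<^bsub>G\<^esub> y) = h x \<oplus>\<^bsub>H\<^esub> h y"
    and b: "\<And>x. x \<in> S \<Longrightarrow> b x \<in> carrier G" and c: "\<And>x. x \<in> S \<Longrightarrow> c (f x) = h (b x)"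
    and p: "Poly_Mapping.keys p \<subseteq> S"
  shows "frag_sum H c (frag_extend (\<lambda>x. frag_of (f x)) p) = h (frag_sum G b p)"
proof -
  interpret G: abelian_group G by fact
  interpret H: abelian_group H by fact
  have h0: "h \<zero>\<^bsub>G\<^esub> = \<zero>\<^bsub>H\<^esub>"
    using h(2)[of "\<zero>\<^bsub>G\<^esub>" "\<zero>\<^bsub>G\<^esub>"] h(1) H.add.r_cancel_one'[of "h \<zero>\<^bsub>G\<^esub>" "h \<zero>\<^bsub>G\<^esub>"] by auto
  have hm: "h (x \<ominus>\<^bsub>G\<^esub> y) = h x \<ominus>\<^bsub>H\<^esub> h y" if "x \<in> carrier G" "y \<in> carrier G" for x y
  proof -
    have 1: "h x = h (x \<ominus>\<^bsub>G\<^esub> y) \<oplus>\<^bsub>H\<^esub> h y"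
      using h(2)[of "x \<ominus>\<^bsub>G\<^esub> y" y] that by (simp add: G.minus_eq G.a_assoc G.l_neg)
    have "h (x \<ominus>\<^bsub>G\<^esub> y) \<in> carrier H" "h y \<in> carrier H" using h(1) that by auto
    then show ?thesis unfolding 1 by (simp add: H.minus_eq H.a_assoc H.r_neg)
  qed
  have ff: "\<And>x. x \<in> f ` S \<Longrightarrow> c x \<in> carrier H" using b c h(1) by auto
  have keys: "Poly_Mapping.keys (frag_extend (\<lambda>x. frag_of (f x)) q) \<subseteq> f ` S"
    if "Poly_Mapping.keys q \<subseteq> S" for q
    using keys_frag_extend[of "\<lambda>x. frag_of (f x)" q] that by (auto simp: keys_frag_of)
  show ?thesis
    using p
  proof (rule free_Abelian_group_induct)
    show "frag_sum H c (frag_extend (\<lambda>x. frag_of (f x)) 0) = h (frag_sum G b 0)"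
      by (simp add: G.frag_sum_0 H.frag_sum_0 h0)
  next
    fix x y
    assume "Poly_Mapping.keys x \<subseteq> S" "Poly_Mapping.keys y \<subseteq> S"
      "frag_sum H c (frag_extend (\<lambda>x. frag_of (f x)) x) = h (frag_sum G b x)"
      "frag_sum H c (frag_extend (\<lambda>x. frag_of (f x)) y) = h (frag_sum G b y)"
    then show "frag_sum H c (frag_extend (\<lambda>x. frag_of (f x)) (x - y)) = h (frag_sum G b (x - y))"
      by (simp add: frag_extend_diff G.frag_sum_diff[OF _ _ b] H.frag_sum_diff[OF keys keys ff]
          hm G.frag_sum_closed[OF _ b])
  next
    fix a assume "a \<in> S"
    then show "frag_sum H c (frag_extend (\<lambda>x. frag_of (f x)) (frag_of a)) = h (frag_sum G b (frag_of a))"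
      using b c h(1) by (simp add: G.frag_sum_of H.frag_sum_of Pi_iff)
  qed
qed

lemma left_pairing_facts:
  assumes "left_pairing R P"
  shows "\<lbrakk>v \<in> carrier (rmod P); w \<in> carrier (lmod P)\<rbrakk> \<Longrightarrow> kappa P v w \<in> carrier R"
    and "\<lbrakk>v \<in> carrier (rmod P); w \<in> carrier (lmod P); u \<in> carrier (lmod P)\<rbrakk> \<Longrightarrow>
      kappa P v (w \<oplus>\<^bsub>lmod P\<^esub> u) = kappa P v w \<oplus>\<^bsub>R\<^esub> kappa P v u"
    and "\<lbrakk>v \<in> carrier (rmod P); w \<in> carrier (lmod P); r \<in> carrier R\<rbrakk> \<Longrightarrow>
      kappa P v (r \<odot>\<^bsub>lmod P\<^esub> w) = r \<otimes>\<^bsub>R\<^esub> kappa P v w"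
    and "\<lbrakk>v \<in> carrier (rmod P); v' \<in> carrier (rmod P); w \<in> carrier (lmod P)\<rbrakk> \<Longrightarrow>
      kappa P (v \<oplus>\<^bsub>rmod P\<^esub> v') w = kappa P v w \<oplus>\<^bsub>R\<^esub> kappa P v' w"
    and "\<lbrakk>v \<in> carrier (rmod P); w \<in> carrier (lmod P); r \<in> carrier R\<rbrakk> \<Longrightarrow>
      kappa P (r \<odot>\<^bsub>rmod P\<^esub> v) w = kappa P v w \<otimes>\<^bsub>R\<^esub> r"
proof -
  have kappa: "kappa P \<in> lin_maps R (rmod P) (left_dual R (lmod P))"
    using assms unfolding left_pairing_def by blast
  then have lin: "kappa P v \<in> lin_maps R (lmod P) (regular_left_module R)" if "v \<in> carrier (rmod P)" for v
    using lin_maps_closed[OF kappa that] by (simp add: left_dual_def)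
  show "\<lbrakk>v \<in> carrier (rmod P); w \<in> carrier (lmod P)\<rbrakk> \<Longrightarrow> kappa P v w \<in> carrier R"
    using lin_maps_closed[OF lin] by (simp add: regular_left_module_def)
  show "\<lbrakk>v \<in> carrier (rmod P); w \<in> carrier (lmod P); u \<in> carrier (lmod P)\<rbrakk> \<Longrightarrow>
      kappa P v (w \<oplus>\<^bsub>lmod P\<^esub> u) = kappa P v w \<oplus>\<^bsub>R\<^esub> kappa P v u"
    using lin unfolding lin_maps_def regular_left_module_def by simp
  show "\<lbrakk>v \<in> carrier (rmod P); w \<in> carrier (lmod P); r \<in> carrier R\<rbrakk> \<Longrightarrow>
      kappa P v (r \<odot>\<^bsub>lmod P\<^esub> w) = r \<otimes>\<^bsub>R\<^esub> kappa P v w"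
    using lin unfolding lin_maps_def regular_left_module_def by simp
  show "\<lbrakk>v \<in> carrier (rmod P); v' \<in> carrier (rmod P); w \<in> carrier (lmod P)\<rbrakk> \<Longrightarrow>
      kappa P (v \<oplus>\<^bsub>rmod P\<^esub> v') w = kappa P v w \<oplus>\<^bsub>R\<^esub> kappa P v' w"
    using kappa unfolding lin_maps_def by (simp add: left_dual_def)
  show "\<lbrakk>v \<in> carrier (rmod P); w \<in> carrier (lmod P); r \<in> carrier R\<rbrakk> \<Longrightarrow>
      kappa P (r \<odot>\<^bsub>rmod P\<^esub> v) w = kappa P v w \<otimes>\<^bsub>R\<^esub> r"
    using kappa unfolding lin_maps_def by (simp add: left_dual_def)
qed

lemma chi_lin_maps:
  assumes "left_pairing R P"
  shows "chi P \<in> lin_maps R (lmod P) (right_dual R (rmod P))"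
proof -
  interpret V: right_module R "rmod P" using assms unfolding left_pairing_def by blast
  show ?thesis
    by (auto simp: lin_maps_def chi_def right_dual_def regular_right_module_def fun_eq_iff
        left_pairing_facts[OF assms])
qed

text \<open>\<open>alpha_map\<close> is well defined: the relations of the tensor product are respected.\<close>

lemma alpha_kernel:
  assumes P: "left_pairing R P" and M: "right_module R M" and v: "v \<in> carrier (rmod P)"
    and p: "p \<in> tensor_kernel R M (lmod P)"
  shows "frag_sum M (\<lambda>(m, w). kappa P v w \<odot>\<^bsub>M\<^esub> m) p = \<zero>\<^bsub>M\<^esub>"
proof -
  interpret M: right_module R M by fact
  have W: "left_module R (lmod P)" using P unfolding left_pairing_def by blast
  interpret W: left_module R "lmod P" by fact
  let ?S = "carrier M \<times> carrier (lmod P)"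
  let ?b = "\<lambda>(m, w). kappa P v w \<odot>\<^bsub>M\<^esub> m"
  note k = left_pairing_facts[OF P]
  have b: "?b x \<in> carrier M" if "x \<in> ?S" for x using that k(1) v by auto
  have diff: "frag_sum M ?b (p - q) = frag_sum M ?b p \<ominus>\<^bsub>M\<^esub> frag_sum M ?b q"
    if "Poly_Mapping.keys p \<subseteq> ?S" "Poly_Mapping.keys q \<subseteq> ?S" for p q
    by (rule M.M.frag_sum_diff[OF that b])
  have of: "frag_sum M ?b (frag_of (m, w)) = kappa P v w \<odot>\<^bsub>M\<^esub> m"
    if "m \<in> carrier M" "w \<in> carrier (lmod P)" for m w
    using M.M.frag_sum_of[of ?b "(m, w)"] b[of "(m, w)"] that by simp
  have keys: "Poly_Mapping.keys (frag_of (m, w)) \<subseteq> ?S"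
    if "m \<in> carrier M" "w \<in> carrier (lmod P)" for m w
    using that by (simp add: keys_frag_of)
  have keysd: "Poly_Mapping.keys (p - q) \<subseteq> ?S"
    if "Poly_Mapping.keys p \<subseteq> ?S" "Poly_Mapping.keys q \<subseteq> ?S" for p q
    using that keys_diff[of p q] by blast
  have canc: "x \<oplus>\<^bsub>M\<^esub> y \<ominus>\<^bsub>M\<^esub> x \<ominus>\<^bsub>M\<^esub> y = \<zero>\<^bsub>M\<^esub>" if "x \<in> carrier M" "y \<in> carrier M" for x y
  proof -
    have "x \<oplus>\<^bsub>M\<^esub> y \<ominus>\<^bsub>M\<^esub> x \<ominus>\<^bsub>M\<^esub> y = (x \<oplus>\<^bsub>M\<^esub> \<ominus>\<^bsub>M\<^esub> x) \<oplus>\<^bsub>M\<^esub> (y \<oplus>\<^bsub>M\<^esub> \<ominus>\<^bsub>M\<^esub> y)"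
      using that by (simp only: M.M.minus_eq M.M.a_ac M.M.a_closed M.M.a_inv_closed)
    then show ?thesis using that by (simp add: M.M.r_neg)
  qed
  show ?thesis
    using M W p
  proof (induction rule: tensor_kernel_induct)
    case zero
    show ?case by (rule M.M.frag_sum_0)
  next
    case (rel p)
    then show ?case
    proof (cases rule: tensor_relatorsE)
      case (1 m n w)
      then show ?thesis
        by (simp add: diff of keys keysd M.smult_r_distr k(1) v canc)
    next
      case (2 m w u)
      then show ?thesis
        by (simp add: diff of keys keysd M.smult_l_distr k v canc)
    next
      case (3 r m w)
      then show ?thesis
        by (simp add: diff of keys keysd M.smult_assoc1 k v M.M.r_neg M.M.minus_eq)
    qed
  next
    case (diff p q)
    then show ?case
      using M.M.frag_sum_diff[OF tensor_kernel_keys[OF M W] tensor_kernel_keys[OF M W] b]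
      by (simp add: M.M.minus_eq)
  qed
qed

lemma alpha_map_coset:
  assumes P: "left_pairing R P" and M: "right_module R M"
    and p: "Poly_Mapping.keys p \<subseteq> carrier M \<times> carrier (lmod P)"
  shows "alpha_map P M (tensor_kernel R M (lmod P) #>\<^bsub>tensor_free M (lmod P)\<^esub> p) =
    (\<lambda>v\<in>carrier (rmod P). frag_sum M (\<lambda>(m, w). kappa P v w \<odot>\<^bsub>M\<^esub> m) p)"
proof -
  interpret M: right_module R M by fact
  have W: "left_module R (lmod P)" using P unfolding left_pairing_def by blast
  let ?F = "\<lambda>p. \<lambda>v\<in>carrier (rmod P). frag_sum M (\<lambda>(m, w). kappa P v w \<odot>\<^bsub>M\<^esub> m) p"
  have "frag_sum M (\<lambda>(m, w). kappa P v w \<odot>\<^bsub>M\<^esub> m) (k + p) = frag_sum M (\<lambda>(m, w). kappa P v w \<odot>\<^bsub>M\<^esub> m) p"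
    if "k \<in> tensor_kernel R M (lmod P)" and v: "v \<in> carrier (rmod P)" for k v
  proof -
    have b: "(case x of (m, w) \<Rightarrow> kappa P v w \<odot>\<^bsub>M\<^esub> m) \<in> carrier M"
      if "x \<in> carrier M \<times> carrier (lmod P)" for x
      using that left_pairing_facts(1)[OF P] v by auto
    show ?thesis
      using M.M.frag_sum_add[OF tensor_kernel_keys[OF M W that(1)] p b] alpha_kernel[OF P M v that(1)]
        M.M.frag_sum_closed[OF p b] by simp
  qed
  then have eq: "?F (k + p) = ?F p" if "k \<in> tensor_kernel R M (lmod P)" for k
    using that by (intro restrict_ext)
  have "?F ` (tensor_kernel R M (lmod P) #>\<^bsub>tensor_free M (lmod P)\<^esub> p) =
      (\<lambda>k. ?F (k + p)) ` tensor_kernel R M (lmod P)"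
    unfolding tensor_coset image_image ..
  also have "\<dots> = (\<lambda>k. ?F p) ` tensor_kernel R M (lmod P)"
    using eq by (rule image_cong[OF refl])
  also have "\<dots> = {?F p}"
    using tensor_kernel_zero[of R M "lmod P"] by (auto simp: image_constant_conv)
  finally show ?thesis unfolding alpha_map_def by simp
qed

lemma alpha_map_tensor:
  assumes "left_pairing R P" "right_module R M" "m \<in> carrier M" "w \<in> carrier (lmod P)"
  shows "alpha_map P M (tensor R M (lmod P) m w) = (\<lambda>v\<in>carrier (rmod P). kappa P v w \<odot>\<^bsub>M\<^esub> m)"
proof -
  interpret M: right_module R M by fact
  show ?thesis
    unfolding tensor_def using assms left_pairing_facts(1)[OF assms(1)]
    by (subst alpha_map_coset) (auto simp: keys_frag_of M.M.frag_sum_of intro!: restrict_ext)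
qed

lemma inj_on_alpha_map_iff:
  assumes P: "left_pairing R P" and M: "right_module R M"
  shows "inj_on (alpha_map P M) (carrier (tensor_product R M (lmod P))) \<longleftrightarrow>
    (\<forall>p. Poly_Mapping.keys p \<subseteq> carrier M \<times> carrier (lmod P) \<and>
       (\<forall>v\<in>carrier (rmod P). frag_sum M (\<lambda>(m, w). kappa P v w \<odot>\<^bsub>M\<^esub> m) p = \<zero>\<^bsub>M\<^esub>) \<longrightarrow>
       p \<in> tensor_kernel R M (lmod P))" (is "inj_on ?a ?C \<longleftrightarrow> ?R")
proof -
  interpret M: right_module R M by fact
  have W: "left_module R (lmod P)" using P unfolding left_pairing_def by blast
  let ?S = "carrier M \<times> carrier (lmod P)"
  let ?K = "tensor_kernel R M (lmod P)"
  let ?b = "\<lambda>v (m, w). kappa P v w \<odot>\<^bsub>M\<^esub> m"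
  have b: "?b v x \<in> carrier M" if "v \<in> carrier (rmod P)" "x \<in> ?S" for x v
    using that left_pairing_facts(1)[OF P] by auto
  show ?thesis
  proof
    assume inj: "inj_on ?a ?C"
    show ?R
    proof (intro allI impI, elim conjE)
      fix p assume p: "Poly_Mapping.keys p \<subseteq> ?S" "\<forall>v\<in>carrier (rmod P). frag_sum M (?b v) p = \<zero>\<^bsub>M\<^esub>"
      have "?a (?K #>\<^bsub>tensor_free M (lmod P)\<^esub> p) = ?a (?K #>\<^bsub>tensor_free M (lmod P)\<^esub> 0)"
        using p by (auto simp: alpha_map_coset[OF P M] M.M.frag_sum_0 intro!: restrict_ext)
      then have "?K #>\<^bsub>tensor_free M (lmod P)\<^esub> p = ?K #>\<^bsub>tensor_free M (lmod P)\<^esub> 0"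
        by (rule inj_onD[OF inj]) (use p in \<open>auto simp: carrier_tensor_product intro: exI[of _ 0]\<close>)
      then show "p \<in> ?K" using tensor_coset_eq_iff[OF M W, of p 0] by simp
    qed
  next
    assume R: ?R
    show "inj_on ?a ?C"
    proof (rule inj_onI)
      fix S T assume "S \<in> ?C" "T \<in> ?C" and eq: "?a S = ?a T"
      then obtain p q where pq: "S = ?K #>\<^bsub>tensor_free M (lmod P)\<^esub> p" "T = ?K #>\<^bsub>tensor_free M (lmod P)\<^esub> q"
        "Poly_Mapping.keys p \<subseteq> ?S" "Poly_Mapping.keys q \<subseteq> ?S"
        unfolding carrier_tensor_product by auto
      have "frag_sum M (?b v) (p - q) = \<zero>\<^bsub>M\<^esub>" if v: "v \<in> carrier (rmod P)" for v
      proof -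
        have "frag_sum M (?b v) p = frag_sum M (?b v) q"
          using fun_cong[OF eq, of v] v pq by (simp add: alpha_map_coset[OF P M])
        then show ?thesis
          using M.M.frag_sum_diff[OF pq(3,4) b[OF v]] M.M.frag_sum_closed[OF pq(4) b[OF v]]
          by (simp add: M.M.minus_eq M.M.r_neg)
      qed
      moreover have "Poly_Mapping.keys (p - q) \<subseteq> ?S"
        using keys_diff[of p q] pq by blast
      ultimately show "S = T" unfolding pq tensor_coset_eq_iff[OF M W] using R by blast
    qed
  qed
qed

lemma left_alpha_pairingD:
  fixes M :: "('a, 'm) module"
  assumes alpha: "left_alpha_pairing R P" and M: "right_module R M"
  shows "inj_on (alpha_map P M) (carrier (tensor_product R M (lmod P)))"
proof -
  interpret M: right_module R M by fact
  have P: "left_pairing R P" using alpha unfolding left_alpha_pairing_def by blast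
  have W: "left_module R (lmod P)" using P unfolding left_pairing_def by blast
  show ?thesis
    unfolding inj_on_alpha_map_iff[OF P M]
  proof (intro allI impI, elim conjE)
    fix p assume p: "Poly_Mapping.keys p \<subseteq> carrier M \<times> carrier (lmod P)"
      "\<forall>v\<in>carrier (rmod P). frag_sum M (\<lambda>(m, w). kappa P v w \<odot>\<^bsub>M\<^esub> m) p = \<zero>\<^bsub>M\<^esub>"
    have "finite (fst ` Poly_Mapping.keys p)" "fst ` Poly_Mapping.keys p \<subseteq> carrier M"
      using p by auto
    then obtain Q and L :: "('a, 'a test) module" and phi psi where Q: "submodule Q R M"
      "fst ` Poly_Mapping.keys p \<subseteq> Q" and L: "right_module R L"
      and phi: "phi \<in> lin_maps R (M\<lparr>carrier := Q\<rparr>) L" and psi: "psi \<in> lin_maps R L (M\<lparr>carrier := Q\<rparr>)"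
      and inverse: "\<And>x. x \<in> Q \<Longrightarrow> psi (phi x) = x"
      using test_module[OF M] by metis
    interpret L: right_module R L by fact
    note MQ = submodule_right_module[OF M Q(1)]
    interpret MQ: right_module R "M\<lparr>carrier := Q\<rparr>" by fact
    let ?p = "frag_extend (\<lambda>(m, w). frag_of (phi m, w)) p"
    have keys: "Poly_Mapping.keys p \<subseteq> Q \<times> carrier (lmod P)" using Q p by force
    have keys': "Poly_Mapping.keys ?p \<subseteq> carrier L \<times> carrier (lmod P)"
      using keys_push[OF keys, of phi "carrier L" "\<lambda>w. w" "carrier (lmod P)"] lin_maps_closed[OF phi]
      by auto
    have "frag_sum L (\<lambda>(m, w). kappa P v w \<odot>\<^bsub>L\<^esub> m) ?p = \<zero>\<^bsub>L\<^esub>" if v: "v \<in> carrier (rmod P)" for v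
    proof -
      let ?b = "\<lambda>(m, w). kappa P v w \<odot>\<^bsub>M\<^esub> m"
      let ?S = "Q \<times> carrier (lmod P)"
      have QM: "Q \<subseteq> carrier M" by (rule submodule_subset[OF Q(1)])
      have k: "kappa P v w \<in> carrier R" if "w \<in> carrier (lmod P)" for w
        using left_pairing_facts(1)[OF P v that] .
      have b: "?b x \<in> carrier (M\<lparr>carrier := Q\<rparr>)" if "x \<in> ?S" for x
        using that k MQ.smult_closed by auto
      have "frag_sum M ?b (frag_extend (\<lambda>x. frag_of (id x)) p) = (\<lambda>x. x) (frag_sum (M\<lparr>carrier := Q\<rparr>) ?b p)"
        by (rule frag_sum_push[OF MQ.M.abelian_group_axioms M.M.abelian_group_axioms _ _ b _ keys])
          (use QM in auto)
      then have "frag_sum (M\<lparr>carrier := Q\<rparr>) ?b p = \<zero>\<^bsub>M\<^esub>"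
        using p(2) v frag_expansion[of p] by simp
      moreover have "frag_sum L (\<lambda>(m, w). kappa P v w \<odot>\<^bsub>L\<^esub> m)
          (frag_extend (\<lambda>x. frag_of (case x of (m, w) \<Rightarrow> (phi m, w))) p) =
        phi (frag_sum (M\<lparr>carrier := Q\<rparr>) ?b p)"
        by (rule frag_sum_push[OF MQ.M.abelian_group_axioms L.M.abelian_group_axioms _ _ b _ keys])
          (use phi k in \<open>auto simp: lin_maps_def\<close>)
      moreover have "phi \<zero>\<^bsub>M\<^esub> = \<zero>\<^bsub>L\<^esub>"
      proof -
        have Q0: "\<zero>\<^bsub>M\<^esub> \<in> Q" using MQ.M.zero_closed by simp
        have "\<forall>x\<in>Q. \<forall>y\<in>Q. phi (x \<oplus>\<^bsub>M\<^esub> y) = phi x \<oplus>\<^bsub>L\<^esub> phi y"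
          using phi unfolding lin_maps_def by simp
        from bspec[OF bspec[OF this Q0] Q0]
        have "phi (\<zero>\<^bsub>M\<^esub> \<oplus>\<^bsub>M\<^esub> \<zero>\<^bsub>M\<^esub>) = phi \<zero>\<^bsub>M\<^esub> \<oplus>\<^bsub>L\<^esub> phi \<zero>\<^bsub>M\<^esub>" .
        moreover have "phi \<zero>\<^bsub>M\<^esub> \<in> carrier L" using lin_maps_closed[OF phi] Q0 by simp
        ultimately show ?thesis using L.M.add.r_cancel_one'[of "phi \<zero>\<^bsub>M\<^esub>" "phi \<zero>\<^bsub>M\<^esub>"] by auto
      qed
      ultimately show ?thesis by (simp add: case_prod_unfold)
    qed
    then have "?p \<in> tensor_kernel R L (lmod P)"
      using alpha L keys' inj_on_alpha_map_iff[OF P L] unfolding left_alpha_pairing_def by blast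
    from tensor_kernel_push[OF L W M W lin_maps_compose[OF psi id_lin_maps[OF submodule_subset[OF Q(1)]]]
        id_lin_maps' this]
    show "p \<in> tensor_kernel R M (lmod P)"
      using frag_extend_inverse[OF keys, of psi phi] inverse by (simp add: comp_def)
  qed
qed

text \<open>The two topologies used above have the intended open sets.\<close>

lemma openin_linear_topology:
  assumes "B \<noteq> {}" "\<And>N N'. \<lbrakk>N \<in> B; N' \<in> B\<rbrakk> \<Longrightarrow> \<exists>L\<in>B. L \<subseteq> N \<inter> N'"
    and "\<And>N x. \<lbrakk>N \<in> B; x \<in> carrier M\<rbrakk> \<Longrightarrow> N +>\<^bsub>M\<^esub> x \<subseteq> carrier M"
  shows "openin (linear_topology M B) U \<longleftrightarrow>
    U \<subseteq> carrier M \<and> (\<forall>x\<in>U. \<exists>N\<in>B. N +>\<^bsub>M\<^esub> x \<subseteq> U)"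
proof -
  have mono: "L +>\<^bsub>M\<^esub> x \<subseteq> N +>\<^bsub>M\<^esub> x" if "L \<subseteq> N" for L N x
    using that unfolding a_r_coset_def r_coset_def by auto
  have "istopology (\<lambda>U. U \<subseteq> carrier M \<and> (\<forall>x\<in>U. \<exists>N\<in>B. N +>\<^bsub>M\<^esub> x \<subseteq> U))"
    unfolding istopology_def
  proof (intro conjI allI impI)
    fix S T
    assume S: "S \<subseteq> carrier M \<and> (\<forall>x\<in>S. \<exists>N\<in>B. N +>\<^bsub>M\<^esub> x \<subseteq> S)"
      and T: "T \<subseteq> carrier M \<and> (\<forall>x\<in>T. \<exists>N\<in>B. N +>\<^bsub>M\<^esub> x \<subseteq> T)"
    show "S \<inter> T \<subseteq> carrier M" using S by auto
    show "\<forall>x\<in>S \<inter> T. \<exists>N\<in>B. N +>\<^bsub>M\<^esub> x \<subseteq> S \<inter> T"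
    proof
      fix x assume "x \<in> S \<inter> T"
      then obtain N N' where "N \<in> B" "N' \<in> B" "N +>\<^bsub>M\<^esub> x \<subseteq> S" "N' +>\<^bsub>M\<^esub> x \<subseteq> T"
        using S T by blast
      moreover from this(1,2) obtain L where "L \<in> B" "L \<subseteq> N \<inter> N'" using assms(2) by blast
      ultimately show "\<exists>N\<in>B. N +>\<^bsub>M\<^esub> x \<subseteq> S \<inter> T" using mono[of L N x] mono[of L N' x] by blast
    qed
  next
    fix K assume K: "\<forall>S\<in>K. S \<subseteq> carrier M \<and> (\<forall>x\<in>S. \<exists>N\<in>B. N +>\<^bsub>M\<^esub> x \<subseteq> S)"
    then show "\<Union> K \<subseteq> carrier M" by auto
    show "\<forall>x\<in>\<Union> K. \<exists>N\<in>B. N +>\<^bsub>M\<^esub> x \<subseteq> \<Union> K"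
      using K by (meson Union_iff Union_upper subset_trans)
  qed
  then show ?thesis unfolding linear_topology_def by (simp add: topology_inverse')
qed

lemma openin_linear_weak_topology:
  assumes P: "left_pairing R P"
  shows "openin (linear_weak_topology R P) U \<longleftrightarrow> U \<subseteq> carrier (rmod P) \<and>
    (\<forall>x\<in>U. \<exists>F. finite F \<and> F \<subseteq> carrier (lmod P) \<and>
       {y \<in> carrier (rmod P). \<forall>w\<in>F. kappa P y w = \<zero>\<^bsub>R\<^esub>} +>\<^bsub>rmod P\<^esub> x \<subseteq> U)"
proof -
  interpret V: right_module R "rmod P" using P unfolding left_pairing_def by blast
  let ?N = "\<lambda>F. {y \<in> carrier (rmod P). \<forall>w\<in>F. kappa P y w = \<zero>\<^bsub>R\<^esub>}"
  let ?B = "{?N F | F. finite F \<and> F \<subseteq> carrier (lmod P)}"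
  have "?B \<noteq> {}" by blast
  moreover have "\<exists>L\<in>?B. L \<subseteq> N \<inter> N'" if "N \<in> ?B" "N' \<in> ?B" for N N'
  proof -
    from that obtain F F' where F: "finite F" "F \<subseteq> carrier (lmod P)" "N = ?N F"
      "finite F'" "F' \<subseteq> carrier (lmod P)" "N' = ?N F'" by blast
    then have "?N (F \<union> F') \<in> ?B" by blast
    moreover have "?N (F \<union> F') \<subseteq> N \<inter> N'" using F by auto
    ultimately show ?thesis by blast
  qed
  moreover have "N +>\<^bsub>rmod P\<^esub> x \<subseteq> carrier (rmod P)" if "N \<in> ?B" "x \<in> carrier (rmod P)" for N x
    by (rule V.M.a_r_coset_subset_G) (use that in auto)
  ultimately have "openin (linear_weak_topology R P) U \<longleftrightarrow> U \<subseteq> carrier (rmod P) \<and>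
      (\<forall>x\<in>U. \<exists>N\<in>?B. N +>\<^bsub>rmod P\<^esub> x \<subseteq> U)"
    unfolding linear_weak_topology_def by (rule openin_linear_topology)
  moreover have "(\<exists>N\<in>?B. Q N) \<longleftrightarrow> (\<exists>F. finite F \<and> F \<subseteq> carrier (lmod P) \<and> Q (?N F))" for Q
    by blast
  ultimately show ?thesis by simp
qed

lemma right_module_left_dual:
  assumes W: "left_module R W"
  shows "right_module R (left_dual R W)"
proof -
  interpret W: left_module R W by fact
  let ?D = "left_dual R W"
  have D: "f \<in> carrier ?D \<longleftrightarrow> f \<in> carrier W \<rightarrow> carrier R \<and> f \<in> extensional (carrier W) \<and>
      (\<forall>x\<in>carrier W. \<forall>y\<in>carrier W. f (x \<oplus>\<^bsub>W\<^esub> y) = f x \<oplus>\<^bsub>R\<^esub> f y) \<and>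
      (\<forall>r\<in>carrier R. \<forall>x\<in>carrier W. f (r \<odot>\<^bsub>W\<^esub> x) = r \<otimes>\<^bsub>R\<^esub> f x)" for f
    unfolding left_dual_def lin_maps_def regular_left_module_def by auto
  have ext: "f = g" if "f \<in> carrier ?D" "g \<in> carrier ?D" "\<And>w. w \<in> carrier W \<Longrightarrow> f w = g w" for f g
    by (rule extensionalityI[where A = "carrier W"]) (use that D in auto)
  have cl: "f w \<in> carrier R" if "f \<in> carrier ?D" "w \<in> carrier W" for f w
    using that D by auto
  have add: "(f \<oplus>\<^bsub>?D\<^esub> g) w = f w \<oplus>\<^bsub>R\<^esub> g w" if "w \<in> carrier W" for f g w
    using that by (simp add: left_dual_def)
  have smult: "(r \<odot>\<^bsub>?D\<^esub> f) w = f w \<otimes>\<^bsub>R\<^esub> r" if "w \<in> carrier W" for f r w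
    using that by (simp add: left_dual_def)
  have zero: "\<zero>\<^bsub>?D\<^esub> w = \<zero>\<^bsub>R\<^esub>" if "w \<in> carrier W" for w
    using that by (simp add: left_dual_def)
  have add_closed: "f \<oplus>\<^bsub>?D\<^esub> g \<in> carrier ?D" if fg: "f \<in> carrier ?D" "g \<in> carrier ?D" for f g
  proof -
    have "f \<oplus>\<^bsub>?D\<^esub> g \<in> extensional (carrier W)" by (simp add: left_dual_def)
    then show ?thesis
      unfolding D using fg[unfolded D] cl[OF fg(1)] cl[OF fg(2)]
      by (auto simp: add W.R.a_ac W.R.r_distr)
  qed
  have smult_closed: "r \<odot>\<^bsub>?D\<^esub> f \<in> carrier ?D" if fr: "f \<in> carrier ?D" "r \<in> carrier R" for f r
  proof -
    have "r \<odot>\<^bsub>?D\<^esub> f \<in> extensional (carrier W)" by (simp add: left_dual_def)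
    then show ?thesis
      unfolding D using fr[unfolded D] cl[OF fr(1)]
      by (auto simp: smult W.R.l_distr W.R.m_assoc)
  qed
  have zero_closed: "\<zero>\<^bsub>?D\<^esub> \<in> carrier ?D"
  proof -
    have "\<zero>\<^bsub>?D\<^esub> \<in> extensional (carrier W)" by (simp add: left_dual_def)
    then show ?thesis unfolding D by (auto simp: zero)
  qed
  have "abelian_group ?D"
  proof (rule abelian_groupI)
    fix f assume f: "f \<in> carrier ?D"
    show "\<exists>g\<in>carrier ?D. g \<oplus>\<^bsub>?D\<^esub> f = \<zero>\<^bsub>?D\<^esub>"
    proof
      let ?g = "(\<ominus>\<^bsub>R\<^esub> \<one>\<^bsub>R\<^esub>) \<odot>\<^bsub>?D\<^esub> f"
      show g: "?g \<in> carrier ?D" by (rule smult_closed) (auto simp: f)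
      show "?g \<oplus>\<^bsub>?D\<^esub> f = \<zero>\<^bsub>?D\<^esub>"
        by (rule ext[OF add_closed[OF g f] zero_closed])
          (simp add: add smult zero cl[OF f] W.R.r_minus W.R.l_neg)
    qed
  qed (auto intro!: add_closed zero_closed ext simp: add zero cl W.R.a_ac)
  then show ?thesis
    by (intro right_module.intro right_module_axioms.intro W.R.ring_axioms)
      (auto intro!: add_closed smult_closed ext
        simp: add smult cl W.R.l_distr W.R.r_distr W.R.m_assoc W.R.ring_axioms)
qed

lemma openin_finite_topology:
  assumes W: "left_module R W"
  shows "openin (finite_topology R W) U \<longleftrightarrow> U \<subseteq> carrier (left_dual R W) \<and>
    (\<forall>f\<in>U. \<exists>F. finite F \<and> F \<subseteq> carrier W \<and>
       {g \<in> carrier (left_dual R W). \<forall>w\<in>F. g w = \<zero>\<^bsub>R\<^esub>} +>\<^bsub>left_dual R W\<^esub> f \<subseteq> U)"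
proof -
  interpret D: right_module R "left_dual R W" using W by (rule right_module_left_dual)
  let ?N = "\<lambda>F. {g \<in> carrier (left_dual R W). \<forall>w\<in>F. g w = \<zero>\<^bsub>R\<^esub>}"
  let ?B = "{?N F | F. finite F \<and> F \<subseteq> carrier W}"
  have "?B \<noteq> {}" by blast
  moreover have "\<exists>L\<in>?B. L \<subseteq> N \<inter> N'" if "N \<in> ?B" "N' \<in> ?B" for N N'
  proof -
    from that obtain F F' where F: "finite F" "F \<subseteq> carrier W" "N = ?N F"
      "finite F'" "F' \<subseteq> carrier W" "N' = ?N F'" by blast
    then have "?N (F \<union> F') \<in> ?B" by blast
    moreover have "?N (F \<union> F') \<subseteq> N \<inter> N'" using F by auto
    ultimately show ?thesis by blast
  qed
  moreover have "N +>\<^bsub>left_dual R W\<^esub> f \<subseteq> carrier (left_dual R W)"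
    if "N \<in> ?B" "f \<in> carrier (left_dual R W)" for N f
    by (rule D.M.a_r_coset_subset_G) (use that in auto)
  ultimately have "openin (finite_topology R W) U \<longleftrightarrow> U \<subseteq> carrier (left_dual R W) \<and>
      (\<forall>x\<in>U. \<exists>N\<in>?B. N +>\<^bsub>left_dual R W\<^esub> x \<subseteq> U)"
    unfolding finite_topology_def by (rule openin_linear_topology)
  moreover have "(\<exists>N\<in>?B. Q N) \<longleftrightarrow> (\<exists>F. finite F \<and> F \<subseteq> carrier W \<and> Q (?N F))" for Q
    by blast
  ultimately show ?thesis by simp
qed

end

theory Submission
  imports Defs
begin

text \<open>An element of M \<otimes> W is represented by a formal combination \<open>p\<close> of
  pairs and is zero exactly when \<open>p\<close> lies in \<open>tensor_kernel\<close>. Injectivity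
  of the tensor maps and of \<alpha> is tested on such \<open>p\<close>.

  For a submodule W' of W, the map \<alpha> of (V, W') is M \<otimes> W' \<rightarrow> M \<otimes> W
  followed by the map \<alpha> of (V, W). If the composite is injective, so is its first factor,
  which gives purity (\<open>pure_submodule_of_alpha\<close>); if both factors are injective, so is
  the composite (\<open>left_alpha_pairing_restrict\<close>).

  The other transfers of the \<alpha>-property rest on \<open>left_alpha_pairing_approx\<close>: if
  every functional on W provided by Q agrees on each finite set with one provided by P, then the
  property passes from Q to P. This settles quotients V/V', since V and V/V' provide the same
  functionals on W', and also the step from \<Omega> to a pairing with dense image. Density in
  either topology means that prescribed values on finite sets are attained
  (\<open>closure_of_linear_weak_topology_eq\<close>, \<open>dense_pairing_iff\<close>). Injectivity
  of \<chi> is injectivity of \<alpha> at M = R, because R \<otimes> W is W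
  (\<open>inj_on_chi_of_alpha\<close>).

  The converse is a separation argument (\<open>dense_pairing_of_inj_chi\<close>). Given w_1, ...,
  w_n, the tuples of values of P form a submodule X of R^n. If the tuple of a functional f lay
  outside X, the cogenerator R would give a linear form on R^n that vanishes on X but not at this
  tuple. Such a form is x \<mapsto> \<Sigma> a_i x_i, so u = \<Sigma> a_i w_i pairs to 0 with all of
  V while f(u) \<noteq> 0, contradicting the injectivity of \<chi>.\<close>

section \<open>Induced pairings and zero elements\<close>

lemma left_pairingI:
  assumes "right_module R (rmod P)" "left_module R (lmod P)"
    and "\<And>v. v \<in> carrier (rmod P) \<Longrightarrow> kappa P v \<in> extensional (carrier (lmod P))"
    and "\<And>v w. \<lbrakk>v \<in> carrier (rmod P); w \<in> carrier (lmod P)\<rbrakk> \<Longrightarrow> kappa P v w \<in> carrier R"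
    and "\<And>v w u. \<lbrakk>v \<in> carrier (rmod P); w \<in> carrier (lmod P); u \<in> carrier (lmod P)\<rbrakk> \<Longrightarrow>
      kappa P v (w \<oplus>\<^bsub>lmod P\<^esub> u) = kappa P v w \<oplus>\<^bsub>R\<^esub> kappa P v u"
    and "\<And>v w r. \<lbrakk>v \<in> carrier (rmod P); w \<in> carrier (lmod P); r \<in> carrier R\<rbrakk> \<Longrightarrow>
      kappa P v (r \<odot>\<^bsub>lmod P\<^esub> w) = r \<otimes>\<^bsub>R\<^esub> kappa P v w"
    and "\<And>v v' w. \<lbrakk>v \<in> carrier (rmod P); v' \<in> carrier (rmod P); w \<in> carrier (lmod P)\<rbrakk> \<Longrightarrow>
      kappa P (v \<oplus>\<^bsub>rmod P\<^esub> v') w = kappa P v w \<oplus>\<^bsub>R\<^esub> kappa P v' w"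
    and "\<And>v w r. \<lbrakk>v \<in> carrier (rmod P); w \<in> carrier (lmod P); r \<in> carrier R\<rbrakk> \<Longrightarrow>
      kappa P (r \<odot>\<^bsub>rmod P\<^esub> v) w = kappa P v w \<otimes>\<^bsub>R\<^esub> r"
  shows "left_pairing R P"
proof -
  interpret V: right_module R "rmod P" by fact
  have "kappa P v \<in> carrier (left_dual R (lmod P))" if "v \<in> carrier (rmod P)" for v
    using that assms(3-6) by (auto simp: left_dual_def lin_maps_def regular_left_module_def)
  moreover have "kappa P (v \<oplus>\<^bsub>rmod P\<^esub> v') = kappa P v \<oplus>\<^bsub>left_dual R (lmod P)\<^esub> kappa P v'"
    if "v \<in> carrier (rmod P)" "v' \<in> carrier (rmod P)" for v v'
    by (rule extensionalityI[where A = "carrier (lmod P)"])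
      (use that assms in \<open>auto simp: left_dual_def\<close>)
  moreover have "kappa P (r \<odot>\<^bsub>rmod P\<^esub> v) = r \<odot>\<^bsub>left_dual R (lmod P)\<^esub> kappa P v"
    if "v \<in> carrier (rmod P)" "r \<in> carrier R" for v r
    by (rule extensionalityI[where A = "carrier (lmod P)"])
      (use that assms in \<open>auto simp: left_dual_def\<close>)
  ultimately show ?thesis
    using assms(1,2) unfolding left_pairing_def lin_maps_def by auto
qed

lemma left_pairing_restrict:
  assumes P: "left_pairing R P" and W': "submodule W' R (lmod P)"
  shows "left_pairing R (restrict_pairing P W')"
proof -
  have V: "right_module R (rmod P)" and W: "left_module R (lmod P)"
    using P unfolding left_pairing_def by blast+
  have sub: "w \<in> carrier (lmod P)" if "w \<in> W'" for w
    using submodule_subset[OF W'] that by blast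
  interpret W': left_module R "(lmod P)\<lparr>carrier := W'\<rparr>" by (rule submodule_left_module[OF W W'])
  have add: "w \<oplus>\<^bsub>lmod P\<^esub> u \<in> W'" if "w \<in> W'" "u \<in> W'" for w u
    using W'.M.a_closed that by simp
  have smult: "r \<odot>\<^bsub>lmod P\<^esub> w \<in> W'" if "w \<in> W'" "r \<in> carrier R" for w r
    using W'.smult_closed that by simp
  interpret V: right_module R "rmod P" by fact
  show ?thesis
    by (rule left_pairingI)
      (simp_all add: restrict_pairing_def V W'.left_module_axioms sub add smult
        left_pairing_facts[OF P])
qed

lemma left_pairing_pullback:
  "\<lbrakk>left_pairing R P; right_module R V; xi \<in> lin_maps R V (rmod P)\<rbrakk> \<Longrightarrow>
    left_pairing R (pullback_pairing P V xi)"
  unfolding left_pairing_def pullback_pairing_def by (auto intro: lin_maps_compose)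

text \<open>The evaluation pairing of the dual with W. Its linear weak topology is the finite
  topology, so one density criterion serves both topologies.\<close>

lemma left_pairing_left_dual:
  "left_module R W \<Longrightarrow> left_pairing R \<lparr>rmod = left_dual R W, lmod = W, kappa = \<lambda>f. f\<rparr>"
  unfolding left_pairing_def by (auto simp: right_module_left_dual id_lin_maps')

lemma left_dual_zero:
  assumes W: "left_module R W" and f: "f \<in> carrier (left_dual R W)"
  shows "f \<zero>\<^bsub>W\<^esub> = \<zero>\<^bsub>R\<^esub>"
proof -
  interpret W: left_module R W by fact
  have "f (\<zero>\<^bsub>W\<^esub> \<oplus>\<^bsub>W\<^esub> \<zero>\<^bsub>W\<^esub>) = f \<zero>\<^bsub>W\<^esub> \<oplus>\<^bsub>R\<^esub> f \<zero>\<^bsub>W\<^esub>" "f \<zero>\<^bsub>W\<^esub> \<in> carrier R"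
    using f W.M.zero_closed unfolding left_dual_def lin_maps_def regular_left_module_def
    by (simp_all add: Pi_iff del: W.M.l_zero W.M.r_zero)
  then show ?thesis using W.R.add.r_cancel_one'[of "f \<zero>\<^bsub>W\<^esub>" "f \<zero>\<^bsub>W\<^esub>"] by auto
qed

lemma right_lin_maps_zero:
  assumes M: "right_module R M" and N: "right_module R N" and h: "h \<in> lin_maps R M N"
  shows "h \<zero>\<^bsub>M\<^esub> = \<zero>\<^bsub>N\<^esub>"
proof -
  interpret M: right_module R M by fact
  interpret N: right_module R N by fact
  have "h (\<zero>\<^bsub>R\<^esub> \<odot>\<^bsub>M\<^esub> \<zero>\<^bsub>M\<^esub>) = \<zero>\<^bsub>R\<^esub> \<odot>\<^bsub>N\<^esub> h \<zero>\<^bsub>M\<^esub>"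
    using h M.M.zero_closed M.R.zero_closed unfolding lin_maps_def by blast
  then show ?thesis
    using lin_maps_closed[OF h M.M.zero_closed] by (simp add: M.smult_l_null N.smult_l_null)
qed

section \<open>Comparing pairings on finite sets\<close>

lemma (in abelian_group) frag_sum_cong:
  assumes "\<And>x. x \<in> Poly_Mapping.keys p \<Longrightarrow> b x = c x"
    and "\<And>x. x \<in> Poly_Mapping.keys p \<Longrightarrow> c x \<in> carrier G"
  shows "frag_sum G b p = frag_sum G c p"
  unfolding frag_sum_def using assms
  by (intro finsum_cong') (auto intro: add.int_pow_closed)

text \<open>Whether \<open>P\<close> is an \<open>\<alpha>\<close>-pairing depends only on the functionals on \<open>lmod P\<close> that \<open>P\<close>
  provides, and on each of them only up to its values on finite sets, because a tensor involves
  finitely many elements of \<open>lmod P\<close>.\<close>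

lemma left_alpha_pairing_approx:
  assumes Q: "left_alpha_pairing R Q" and P: "left_pairing R P" and eq: "lmod Q = lmod P"
    and approx: "\<And>v F. \<lbrakk>v \<in> carrier (rmod Q); finite F; F \<subseteq> carrier (lmod P)\<rbrakk> \<Longrightarrow>
      \<exists>v'\<in>carrier (rmod P). \<forall>w\<in>F. kappa P v' w = kappa Q v w"
  shows "left_alpha_pairing R P"
proof -
  have lpQ: "left_pairing R Q" using Q unfolding left_alpha_pairing_def by blast
  have "inj_on (alpha_map P M) (carrier (tensor_product R M (lmod P)))"
    if M: "right_module R M" for M :: "('a, 'a test) module"
    unfolding inj_on_alpha_map_iff[OF P M]
  proof (intro allI impI, elim conjE)
    fix p assume p: "Poly_Mapping.keys p \<subseteq> carrier M \<times> carrier (lmod P)"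
      "\<forall>v\<in>carrier (rmod P). frag_sum M (\<lambda>(m, w). kappa P v w \<odot>\<^bsub>M\<^esub> m) p = \<zero>\<^bsub>M\<^esub>"
    interpret M: right_module R M by fact
    have "frag_sum M (\<lambda>(m, w). kappa Q v w \<odot>\<^bsub>M\<^esub> m) p = \<zero>\<^bsub>M\<^esub>" if v: "v \<in> carrier (rmod Q)" for v
    proof -
      have "finite (snd ` Poly_Mapping.keys p)" "snd ` Poly_Mapping.keys p \<subseteq> carrier (lmod P)"
        using p(1) by auto
      from approx[OF v this] obtain v' where v': "v' \<in> carrier (rmod P)"
        "\<forall>w\<in>snd ` Poly_Mapping.keys p. kappa P v' w = kappa Q v w" by blast
      have "frag_sum M (\<lambda>(m, w). kappa Q v w \<odot>\<^bsub>M\<^esub> m) p =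
          frag_sum M (\<lambda>(m, w). kappa P v' w \<odot>\<^bsub>M\<^esub> m) p"
        by (rule M.M.frag_sum_cong)
          (use v' p(1) left_pairing_facts(1)[OF P v'(1)] in \<open>force+\<close>)
      then show ?thesis using p(2) v'(1) by simp
    qed
    then show "p \<in> tensor_kernel R M (lmod P)"
      using iffD1[OF inj_on_alpha_map_iff[OF lpQ M] left_alpha_pairingD[OF Q M]] p(1) eq by simp
  qed
  then show ?thesis using P unfolding left_alpha_pairing_def by blast
qed

section \<open>Restriction to a submodule of W, and purity\<close>

lemma frag_sum_restrict_pairing:
  assumes P: "left_pairing R P" and W': "submodule W' R (lmod P)" and M: "right_module R M"
    and v: "v \<in> carrier (rmod P)" and p: "Poly_Mapping.keys p \<subseteq> carrier M \<times> W'"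
  shows "frag_sum M (\<lambda>(m, w). kappa (restrict_pairing P W') v w \<odot>\<^bsub>M\<^esub> m) p =
    frag_sum M (\<lambda>(m, w). kappa P v w \<odot>\<^bsub>M\<^esub> m) p"
proof -
  interpret M: right_module R M by fact
  have "kappa P v w \<in> carrier R" if "w \<in> W'" for w
    using left_pairing_facts(1)[OF P v] submodule_subset[OF W'] that by blast
  then show ?thesis
    by (intro M.M.frag_sum_cong) (use p in \<open>force simp: restrict_pairing_def\<close>)+
qed

text \<open>If \<open>p\<close> over W' vanishes in M \<otimes> W, then all its values under the
  pairing vanish by \<open>alpha_kernel\<close>. These are also its values under the restricted
  pairing, whose \<alpha> is injective, so \<open>p\<close> already vanishes in M \<otimes>
  W'.\<close>

lemma pure_submodule_of_alpha:
  assumes P: "left_pairing R P" and W': "submodule W' R (lmod P)"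
    and alpha: "left_alpha_pairing R (restrict_pairing P W')"
  shows "pure_submodule W' R (lmod P)"
proof -
  let ?P' = "restrict_pairing P W'"
  have W: "left_module R (lmod P)" using P unfolding left_pairing_def by blast
  note P' = left_pairing_restrict[OF P W']
  have "inj_on (tensor_map R M (lmod P) (\<lambda>w. w))
      (carrier (tensor_product R M ((lmod P)\<lparr>carrier := W'\<rparr>)))"
    if M: "right_module R M" for M :: "('a, 'a test) module"
    unfolding inj_on_tensor_map_iff[OF M W W']
  proof (intro allI impI, elim conjE)
    fix p assume p: "Poly_Mapping.keys p \<subseteq> carrier M \<times> W'" "p \<in> tensor_kernel R M (lmod P)"
    have "frag_sum M (\<lambda>(m, w). kappa ?P' v w \<odot>\<^bsub>M\<^esub> m) p = \<zero>\<^bsub>M\<^esub>" if "v \<in> carrier (rmod P)" for v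
      using frag_sum_restrict_pairing[OF P W' M that p(1)] alpha_kernel[OF P M that p(2)] by simp
    then show "p \<in> tensor_kernel R M ((lmod P)\<lparr>carrier := W'\<rparr>)"
      using left_alpha_pairingD[OF alpha M] p(1) unfolding inj_on_alpha_map_iff[OF P' M]
      by (simp add: restrict_pairing_def)
  qed
  then show ?thesis using W' unfolding pure_submodule_def by blast
qed

text \<open>A composite of injections: vanishing values force \<open>p\<close> to be zero in M
  \<otimes> W by the \<alpha>-property of P, and purity lifts this to M \<otimes> W'.\<close>

lemma left_alpha_pairing_restrict:
  assumes alpha: "left_alpha_pairing R P" and pure: "pure_submodule W' R (lmod P)"
  shows "left_alpha_pairing R (restrict_pairing P W')"
proof -
  let ?P' = "restrict_pairing P W'"
  have P: "left_pairing R P" using alpha unfolding left_alpha_pairing_def by blast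
  have W: "left_module R (lmod P)" using P unfolding left_pairing_def by blast
  have W': "submodule W' R (lmod P)" using pure unfolding pure_submodule_def by blast
  note P' = left_pairing_restrict[OF P W']
  have "inj_on (alpha_map ?P' M) (carrier (tensor_product R M (lmod ?P')))"
    if M: "right_module R M" for M :: "('a, 'a test) module"
    unfolding inj_on_alpha_map_iff[OF P' M]
  proof (intro allI impI, elim conjE)
    fix p assume "Poly_Mapping.keys p \<subseteq> carrier M \<times> carrier (lmod ?P')"
      and 0: "\<forall>v\<in>carrier (rmod ?P'). frag_sum M (\<lambda>(m, w). kappa ?P' v w \<odot>\<^bsub>M\<^esub> m) p = \<zero>\<^bsub>M\<^esub>"
    then have p: "Poly_Mapping.keys p \<subseteq> carrier M \<times> W'" by (simp add: restrict_pairing_def)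
    have "frag_sum M (\<lambda>(m, w). kappa P v w \<odot>\<^bsub>M\<^esub> m) p = \<zero>\<^bsub>M\<^esub>" if v: "v \<in> carrier (rmod P)" for v
    proof -
      have "v \<in> carrier (rmod ?P')" using v by (simp add: restrict_pairing_def)
      then show ?thesis using frag_sum_restrict_pairing[OF P W' M v p] 0 by metis
    qed
    moreover have "Poly_Mapping.keys p \<subseteq> carrier M \<times> carrier (lmod P)"
      using p submodule_subset[OF W'] by blast
    ultimately have "p \<in> tensor_kernel R M (lmod P)"
      using left_alpha_pairingD[OF alpha M] unfolding inj_on_alpha_map_iff[OF P M] by blast
    then show "p \<in> tensor_kernel R M (lmod ?P')"
      using pure_submoduleD[OF pure M W] p unfolding inj_on_tensor_map_iff[OF M W W']
      by (simp add: restrict_pairing_def)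
  qed
  then show ?thesis using P' unfolding left_alpha_pairing_def by blast
qed

section \<open>Quotients of V and subpairings\<close>

lemma submodule_abelian_subgroup:
  assumes "right_module R M" "submodule H R M"
  shows "abelian_subgroup H M"
proof -
  interpret M: right_module R M by fact
  interpret H: submodule H R M by fact
  show ?thesis
    by (rule abelian_subgroupI3)
      (simp_all add: additive_subgroup_def H.subgroup_axioms M.M.abelian_group_axioms)
qed

text \<open>\<open>quot_module\<close> defines the scalar action as a union over a whole coset.
  Since H is closed under scalars, all cosets in that union coincide, so the action can be computed
  on one representative.\<close>

lemma quot_smult_coset:
  assumes M: "right_module R M" and H: "submodule H R M" and r: "r \<in> carrier R"
    and x: "x \<in> carrier M"
  shows "r \<odot>\<^bsub>quot_module M H\<^esub> (H +>\<^bsub>M\<^esub> x) = H +>\<^bsub>M\<^esub> (r \<odot>\<^bsub>M\<^esub> x)"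
proof -
  interpret M: right_module R M by fact
  interpret H: abelian_subgroup H M using M H by (rule submodule_abelian_subgroup)
  have eq: "H +>\<^bsub>M\<^esub> (r \<odot>\<^bsub>M\<^esub> y) = H +>\<^bsub>M\<^esub> (r \<odot>\<^bsub>M\<^esub> x)" if y: "y \<in> H +>\<^bsub>M\<^esub> x" for y
  proof -
    obtain h where h: "h \<in> H" "y = h \<oplus>\<^bsub>M\<^esub> x"
      using y unfolding a_r_coset_def' by blast
    have "r \<odot>\<^bsub>M\<^esub> h \<in> H" using H r h(1) unfolding submodule_def submodule_axioms_def by blast
    moreover have "r \<odot>\<^bsub>M\<^esub> y = r \<odot>\<^bsub>M\<^esub> h \<oplus>\<^bsub>M\<^esub> r \<odot>\<^bsub>M\<^esub> x"
      using h r x H.a_subset by (auto simp: M.smult_r_distr)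
    ultimately have "r \<odot>\<^bsub>M\<^esub> y \<in> H +>\<^bsub>M\<^esub> (r \<odot>\<^bsub>M\<^esub> x)" unfolding a_r_coset_def' by blast
    then show ?thesis
      using M.M.a_repr_independence[OF _ _ H.a_subgroup] M.smult_closed[OF r x] by blast
  qed
  moreover have "x \<in> H +>\<^bsub>M\<^esub> x" by (rule H.a_rcos_self[OF x])
  ultimately have "(\<Union>y\<in>H +>\<^bsub>M\<^esub> x. H +>\<^bsub>M\<^esub> (r \<odot>\<^bsub>M\<^esub> y)) = H +>\<^bsub>M\<^esub> (r \<odot>\<^bsub>M\<^esub> x)" by blast
  then show ?thesis by (simp add: quot_module_def)
qed

lemma quot_add_coset:
  assumes "right_module R M" "submodule H R M" "x \<in> carrier M" "y \<in> carrier M"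
  shows "(H +>\<^bsub>M\<^esub> x) \<oplus>\<^bsub>quot_module M H\<^esub> (H +>\<^bsub>M\<^esub> y) = H +>\<^bsub>M\<^esub> (x \<oplus>\<^bsub>M\<^esub> y)"
  using abelian_subgroup.a_rcos_sum[OF submodule_abelian_subgroup[OF assms(1,2)] assms(3,4)]
  by (simp add: quot_module_def)

lemma quot_carrier: "carrier (quot_module M H) = (\<lambda>x. H +>\<^bsub>M\<^esub> x) ` carrier M"
  unfolding quot_module_def A_RCOSETS_def' by auto

lemma quot_zero:
  assumes "right_module R M" "submodule H R M"
  shows "\<zero>\<^bsub>quot_module M H\<^esub> = H +>\<^bsub>M\<^esub> \<zero>\<^bsub>M\<^esub>"
proof -
  interpret M: right_module R M by fact
  show ?thesis using M.M.a_coset_add_zero[OF submodule_subset[OF assms(2)]] by (simp add: quot_module_def)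
qed

lemma right_module_quot:
  assumes M: "right_module R M" and H: "submodule H R M"
  shows "right_module R (quot_module M H)"
proof -
  interpret M: right_module R M by fact
  note [simp] = quot_add_coset[OF M H] quot_smult_coset[OF M H] quot_zero[OF M H]
  have "abelian_group (quot_module M H)"
  proof (rule abelian_groupI)
    fix x assume "x \<in> carrier (quot_module M H)"
    then obtain a where a: "a \<in> carrier M" "x = H +>\<^bsub>M\<^esub> a" unfolding quot_carrier by blast
    then show "\<exists>y\<in>carrier (quot_module M H). y \<oplus>\<^bsub>quot_module M H\<^esub> x = \<zero>\<^bsub>quot_module M H\<^esub>"
      by (intro bexI[of _ "H +>\<^bsub>M\<^esub> (\<ominus>\<^bsub>M\<^esub> a)"]) (auto simp: quot_carrier M.M.l_neg)
  qed (auto simp: quot_carrier M.M.a_ac)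
  then show ?thesis
    by (intro right_module.intro right_module_axioms.intro M.R.ring_axioms)
      (auto simp: quot_carrier M.smult_l_distr M.smult_r_distr M.smult_assoc1 M.R.ring_axioms)
qed

lemma quot_proj_lin_maps:
  assumes M: "right_module R M" and H: "submodule H R M"
  shows "(\<lambda>x. H +>\<^bsub>M\<^esub> x) \<in> lin_maps R M (quot_module M H)"
  unfolding lin_maps_def
  by (auto simp: quot_carrier quot_add_coset[OF M H] quot_smult_coset[OF M H])

text \<open>Two representatives of a coset differ by an element of V', which pairs to 0 with W'. The
  image of the coset is therefore a singleton, and \<open>the_elem\<close> in
  \<open>subpairing\<close> returns its element.\<close>

lemma kappa_subpairing:
  assumes P: "left_pairing R P" and V': "submodule V' R (rmod P)" and W': "submodule W' R (lmod P)"
    and ann: "pairing_annihilates R P V' W'" and v: "v \<in> carrier (rmod P)" and w: "w \<in> W'"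
  shows "kappa (subpairing P V' W') (V' +>\<^bsub>rmod P\<^esub> v) w = kappa P v w"
proof -
  have V: "right_module R (rmod P)" using P unfolding left_pairing_def by blast
  interpret V: right_module R "rmod P" by fact
  interpret V': abelian_subgroup V' "rmod P" by (rule submodule_abelian_subgroup[OF V V'])
  have wW: "w \<in> carrier (lmod P)" using submodule_subset[OF W'] w by blast
  have "kappa P (h \<oplus>\<^bsub>rmod P\<^esub> v) w = kappa P v w" if "h \<in> V'" for h
  proof -
    have "h \<in> carrier (rmod P)" using submodule_subset[OF V'] that by blast
    moreover have "kappa P h w = \<zero>\<^bsub>R\<^esub>" using ann that w unfolding pairing_annihilates_def by blast
    ultimately show ?thesis using v wW left_pairing_facts[OF P] by simp
  qed
  then have "(\<lambda>v. kappa P v w) ` (V' +>\<^bsub>rmod P\<^esub> v) = {kappa P v w}"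
    using V'.a_rcos_self[OF v] unfolding a_r_coset_def' by blast
  then show ?thesis using w by (simp add: subpairing_def)
qed

lemma left_pairing_subpairing:
  assumes P: "left_pairing R P" and V': "submodule V' R (rmod P)" and W': "submodule W' R (lmod P)"
    and ann: "pairing_annihilates R P V' W'"
  shows "left_pairing R (subpairing P V' W')"
proof -
  let ?Q = "subpairing P V' W'"
  have V: "right_module R (rmod P)" and W: "left_module R (lmod P)"
    using P unfolding left_pairing_def by blast+
  have rmod: "rmod ?Q = quot_module (rmod P) V'" and lmod: "lmod ?Q = (lmod P)\<lparr>carrier := W'\<rparr>"
    by (simp_all add: subpairing_def)
  interpret V: right_module R "rmod P" by fact
  have sub: "w \<in> carrier (lmod P)" if "w \<in> W'" for w
    using submodule_subset[OF W'] that by blast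
  interpret W': left_module R "(lmod P)\<lparr>carrier := W'\<rparr>" by (rule submodule_left_module[OF W W'])
  have add: "w \<oplus>\<^bsub>lmod P\<^esub> u \<in> W'" if "w \<in> W'" "u \<in> W'" for w u
    using W'.M.a_closed that by simp
  have smult: "r \<odot>\<^bsub>lmod P\<^esub> w \<in> W'" if "w \<in> W'" "r \<in> carrier R" for w r
    using W'.smult_closed that by simp
  note k = kappa_subpairing[OF P V' W' ann] and q = quot_add_coset[OF V V'] quot_smult_coset[OF V V']
  show ?thesis
  proof (rule left_pairingI)
    show "right_module R (rmod ?Q)" unfolding rmod by (rule right_module_quot[OF V V'])
    show "left_module R (lmod ?Q)" unfolding lmod by (rule W'.left_module_axioms)
    show "kappa ?Q v \<in> extensional (carrier (lmod ?Q))" for v by (simp add: subpairing_def)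
  qed (auto simp: rmod lmod quot_carrier k q sub add smult left_pairing_facts[OF P])
qed

text \<open>A coset of V' and any of its representatives induce the same functional on W', so
  \<open>left_alpha_pairing_approx\<close> applies in both directions with exact agreement.\<close>

lemma left_alpha_pairing_subpairing_iff:
  assumes P: "left_pairing R P" and V': "submodule V' R (rmod P)" and W': "submodule W' R (lmod P)"
    and ann: "pairing_annihilates R P V' W'"
  shows "left_alpha_pairing R (subpairing P V' W') \<longleftrightarrow> left_alpha_pairing R (restrict_pairing P W')"
proof
  note P' = left_pairing_restrict[OF P W'] and k = kappa_subpairing[OF P V' W' ann]
  assume "left_alpha_pairing R (subpairing P V' W')"
  then show "left_alpha_pairing R (restrict_pairing P W')"
  proof (rule left_alpha_pairing_approx[OF _ P'])
    show "lmod (subpairing P V' W') = lmod (restrict_pairing P W')"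
      by (simp add: subpairing_def restrict_pairing_def)
    fix C F
    assume "C \<in> carrier (rmod (subpairing P V' W'))" "F \<subseteq> carrier (lmod (restrict_pairing P W'))"
    then obtain v where v: "v \<in> carrier (rmod P)" "C = V' +>\<^bsub>rmod P\<^esub> v" "F \<subseteq> W'"
      by (auto simp: subpairing_def restrict_pairing_def quot_carrier)
    then have "kappa (restrict_pairing P W') v w = kappa (subpairing P V' W') C w" if "w \<in> F" for w
      using that by (auto simp: k restrict_pairing_def)
    moreover have "v \<in> carrier (rmod (restrict_pairing P W'))" using v by (simp add: restrict_pairing_def)
    ultimately show "\<exists>v'\<in>carrier (rmod (restrict_pairing P W')).
        \<forall>w\<in>F. kappa (restrict_pairing P W') v' w = kappa (subpairing P V' W') C w" by blast
  qed
next
  note Q = left_pairing_subpairing[OF assms] and k = kappa_subpairing[OF P V' W' ann]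
  assume "left_alpha_pairing R (restrict_pairing P W')"
  then show "left_alpha_pairing R (subpairing P V' W')"
  proof (rule left_alpha_pairing_approx[OF _ Q])
    show "lmod (restrict_pairing P W') = lmod (subpairing P V' W')"
      by (simp add: subpairing_def restrict_pairing_def)
    fix v F
    assume "v \<in> carrier (rmod (restrict_pairing P W'))" "F \<subseteq> carrier (lmod (subpairing P V' W'))"
    then have v: "v \<in> carrier (rmod P)" "F \<subseteq> W'"
      by (auto simp: subpairing_def restrict_pairing_def)
    then have "kappa (subpairing P V' W') (V' +>\<^bsub>rmod P\<^esub> v) w = kappa (restrict_pairing P W') v w"
      if "w \<in> F" for w
      using that by (auto simp: k restrict_pairing_def)
    moreover have "V' +>\<^bsub>rmod P\<^esub> v \<in> carrier (rmod (subpairing P V' W'))"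
      using v by (simp add: subpairing_def quot_carrier)
    ultimately show "\<exists>C\<in>carrier (rmod (subpairing P V' W')).
        \<forall>w\<in>F. kappa (subpairing P V' W') C w = kappa (restrict_pairing P W') v w" by blast
  qed
qed

section \<open>Density as attainment of finitely many values\<close>

text \<open>The basic neighbourhood of y given by F consists of the elements with the same values as
  y on F. A set is therefore dense when it meets every such neighbourhood.\<close>

lemma closure_of_linear_weak_topology_eq:
  assumes P: "left_pairing R P" and S: "S \<subseteq> carrier (rmod P)"
  shows "linear_weak_topology R P closure_of S = carrier (rmod P) \<longleftrightarrow>
    (\<forall>y\<in>carrier (rmod P). \<forall>F. finite F \<and> F \<subseteq> carrier (lmod P) \<longrightarrow>
       (\<exists>s\<in>S. \<forall>w\<in>F. kappa P s w = kappa P y w))" (is "?L \<longleftrightarrow> ?R")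
proof -
  interpret V: right_module R "rmod P" using P unfolding left_pairing_def by blast
  let ?T = "linear_weak_topology R P"
  let ?N = "\<lambda>F. {y \<in> carrier (rmod P). \<forall>w\<in>F. kappa P y w = \<zero>\<^bsub>R\<^esub>}"
  note k = left_pairing_facts[OF P]
  note opn = openin_linear_weak_topology[OF P]
  have coset: "?N F +>\<^bsub>rmod P\<^esub> x = {y \<in> carrier (rmod P). \<forall>w\<in>F. kappa P y w = kappa P x w}"
    if x: "x \<in> carrier (rmod P)" and F: "F \<subseteq> carrier (lmod P)" for x F
  proof (intro equalityI subsetI)
    fix y assume "y \<in> ?N F +>\<^bsub>rmod P\<^esub> x"
    then obtain n where "n \<in> ?N F" "y = n \<oplus>\<^bsub>rmod P\<^esub> x" unfolding a_r_coset_def' by blast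
    then show "y \<in> {y \<in> carrier (rmod P). \<forall>w\<in>F. kappa P y w = kappa P x w}"
      using x F k by (auto simp: subset_iff)
  next
    fix y assume y: "y \<in> {y \<in> carrier (rmod P). \<forall>w\<in>F. kappa P y w = kappa P x w}"
    have yx: "y = (y \<ominus>\<^bsub>rmod P\<^esub> x) \<oplus>\<^bsub>rmod P\<^esub> x"
      using x y by (simp add: V.M.minus_eq V.M.a_assoc V.M.l_neg)
    have "kappa P (y \<ominus>\<^bsub>rmod P\<^esub> x) w = \<zero>\<^bsub>R\<^esub>" if "w \<in> F" for w
    proof -
      have w: "w \<in> carrier (lmod P)" using that F by blast
      have d: "y \<ominus>\<^bsub>rmod P\<^esub> x \<in> carrier (rmod P)" using x y by simp
      have "kappa P x w = kappa P y w" using y that by simp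
      also have "\<dots> = kappa P ((y \<ominus>\<^bsub>rmod P\<^esub> x) \<oplus>\<^bsub>rmod P\<^esub> x) w" by (rule arg_cong[OF yx])
      also have "\<dots> = kappa P (y \<ominus>\<^bsub>rmod P\<^esub> x) w \<oplus>\<^bsub>R\<^esub> kappa P x w" by (rule k(4)[OF d x w])
      finally show ?thesis
        using V.R.add.r_cancel_one'[OF k(1)[OF x w] k(1)[OF d w]] by simp
    qed
    then have "y \<ominus>\<^bsub>rmod P\<^esub> x \<in> ?N F" using x y by simp
    then show "y \<in> ?N F +>\<^bsub>rmod P\<^esub> x" unfolding a_r_coset_def' using yx by blast
  qed
  have top: "topspace ?T = carrier (rmod P)"
  proof
    show "topspace ?T \<subseteq> carrier (rmod P)" using opn[of "topspace ?T"] by simp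
    \<comment> \<open>For empty F the basic neighbourhood of any point is the whole carrier.\<close>
    have "openin ?T (carrier (rmod P))"
      unfolding opn using coset[of _ "{}"] by (intro conjI ballI exI[of _ "{}"]) auto
    then show "carrier (rmod P) \<subseteq> topspace ?T" by (rule openin_subset)
  qed
  \<comment> \<open>Each point z of this set has the same values on F as y, so the basic
    neighbourhood of z given by F is the set itself.\<close>
  have basic: "openin ?T {z \<in> carrier (rmod P). \<forall>w\<in>F. kappa P z w = kappa P y w}"
    if F: "finite F" "F \<subseteq> carrier (lmod P)" for y F
    unfolding opn by (intro conjI ballI exI[of _ F]) (use F in \<open>auto simp: coset\<close>)
  show ?thesis
  proof
    assume L: ?L
    show ?R
    proof (intro ballI allI impI)
      fix y F assume y: "y \<in> carrier (rmod P)" and F: "finite F \<and> F \<subseteq> carrier (lmod P)"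
      have "y \<in> ?T closure_of S" using L y by simp
      then have "\<exists>s. s \<in> S \<and> s \<in> {z \<in> carrier (rmod P). \<forall>w\<in>F. kappa P z w = kappa P y w}"
        by (rule in_closure_of[THEN iffD1, THEN conjunct2, rule_format])
          (use basic[of F y] F y in auto)
      then show "\<exists>s\<in>S. \<forall>w\<in>F. kappa P s w = kappa P y w" by blast
    qed
  next
    assume R: ?R
    have "y \<in> ?T closure_of S" if y: "y \<in> carrier (rmod P)" for y
      unfolding in_closure_of top
    proof (intro conjI allI impI y, elim conjE)
      fix U assume "y \<in> U" "openin ?T U"
      then obtain F where F: "finite F" "F \<subseteq> carrier (lmod P)" "?N F +>\<^bsub>rmod P\<^esub> y \<subseteq> U"
        unfolding opn by blast
      then obtain s where "s \<in> S" "\<forall>w\<in>F. kappa P s w = kappa P y w" using R y by blast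
      then have "s \<in> ?N F +>\<^bsub>rmod P\<^esub> y" using coset[OF y F(2)] S by auto
      then show "\<exists>s. s \<in> S \<and> s \<in> U" using \<open>s \<in> S\<close> F(3) by blast
    qed
    then show ?L using closure_of_subset_topspace[of ?T S] top by blast
  qed
qed

text \<open>The closure criterion is applied to the evaluation pairing \<open>?D\<close> and the
  image of \<open>kappa P\<close>.\<close>

lemma dense_pairing_iff:
  assumes P: "left_pairing R P"
  shows "dense_pairing R P \<longleftrightarrow>
    (\<forall>f\<in>carrier (left_dual R (lmod P)). \<forall>F. finite F \<and> F \<subseteq> carrier (lmod P) \<longrightarrow>
       (\<exists>v\<in>carrier (rmod P). \<forall>w\<in>F. kappa P v w = f w))"
proof -
  have W: "left_module R (lmod P)" using P unfolding left_pairing_def by blast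
  have sub: "kappa P ` carrier (rmod P) \<subseteq> carrier (left_dual R (lmod P))"
    using P unfolding left_pairing_def lin_maps_def by auto
  let ?D = "\<lparr>rmod = left_dual R (lmod P), lmod = lmod P, kappa = \<lambda>f. f\<rparr>"
  have "finite_topology R (lmod P) = linear_weak_topology R ?D"
    unfolding finite_topology_def linear_weak_topology_def by simp
  then have "dense_pairing R P \<longleftrightarrow>
    (\<forall>f\<in>carrier (left_dual R (lmod P)). \<forall>F. finite F \<and> F \<subseteq> carrier (lmod P) \<longrightarrow>
       (\<exists>g\<in>kappa P ` carrier (rmod P). \<forall>w\<in>F. g w = f w))"
    using closure_of_linear_weak_topology_eq[OF left_pairing_left_dual[OF W],
        unfolded pairing.simps, OF sub]
    unfolding dense_pairing_def by (simp only: pairing.simps)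
  then show ?thesis by (simp only: bex_simps)
qed

section \<open>The case M = R\<close>

lemma right_module_regular: "ring R \<Longrightarrow> right_module R (regular_right_module R)"
proof -
  assume "ring R"
  then interpret R: ring R .
  have "abelian_group (regular_right_module R)"
  proof (rule abelian_groupI)
    fix x assume "x \<in> carrier (regular_right_module R)"
    then show "\<exists>y\<in>carrier (regular_right_module R).
        y \<oplus>\<^bsub>regular_right_module R\<^esub> x = \<zero>\<^bsub>regular_right_module R\<^esub>"
      by (intro bexI[of _ "\<ominus>\<^bsub>R\<^esub> x"]) (auto simp: regular_right_module_def R.l_neg)
  qed (auto simp: regular_right_module_def R.a_ac)
  then show ?thesis
    by (intro right_module.intro right_module_axioms.intro R.ring_axioms)
      (auto simp: regular_right_module_def R.l_distr R.r_distr R.m_assoc R.ring_axioms)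
qed

text \<open>This is the well-definedness of R \<otimes> W \<rightarrow> W, r \<otimes> w \<mapsto> r
  w. The third relator is respected by associativity, as the action on the regular right module is
  multiplication from the right.\<close>

lemma frag_sum_regular_tensor_kernel:
  assumes W: "left_module R W" and p: "p \<in> tensor_kernel R (regular_right_module R) W"
  shows "frag_sum W (\<lambda>(r, w). r \<odot>\<^bsub>W\<^esub> w) p = \<zero>\<^bsub>W\<^esub>"
proof -
  interpret W: left_module R W by fact
  let ?M = "regular_right_module R"
  have M: "right_module R ?M" by (rule right_module_regular[OF W.R.ring_axioms])
  have M': "carrier ?M = carrier R" "(\<oplus>\<^bsub>?M\<^esub>) = (\<oplus>\<^bsub>R\<^esub>)" "r \<odot>\<^bsub>?M\<^esub> x = x \<otimes>\<^bsub>R\<^esub> r" for r x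
    by (simp_all add: regular_right_module_def)
  let ?S = "carrier R \<times> carrier W"
  let ?b = "\<lambda>(r, w). r \<odot>\<^bsub>W\<^esub> w"
  have b: "?b x \<in> carrier W" if "x \<in> ?S" for x using that by auto
  have diff: "frag_sum W ?b (p - q) = frag_sum W ?b p \<ominus>\<^bsub>W\<^esub> frag_sum W ?b q"
    if "Poly_Mapping.keys p \<subseteq> ?S" "Poly_Mapping.keys q \<subseteq> ?S" for p q
    by (rule W.M.frag_sum_diff[OF that b])
  have of: "frag_sum W ?b (frag_of (r, w)) = r \<odot>\<^bsub>W\<^esub> w" if "r \<in> carrier R" "w \<in> carrier W" for r w
    using W.M.frag_sum_of[of ?b "(r, w)"] that by simp
  have keys: "Poly_Mapping.keys (frag_of (r, w)) \<subseteq> ?S" if "r \<in> carrier R" "w \<in> carrier W" for r w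
    using that by (simp add: keys_frag_of)
  have keysd: "Poly_Mapping.keys (p - q) \<subseteq> ?S"
    if "Poly_Mapping.keys p \<subseteq> ?S" "Poly_Mapping.keys q \<subseteq> ?S" for p q
    using that keys_diff[of p q] by blast
  have canc: "x \<oplus>\<^bsub>W\<^esub> y \<ominus>\<^bsub>W\<^esub> x \<ominus>\<^bsub>W\<^esub> y = \<zero>\<^bsub>W\<^esub>" if "x \<in> carrier W" "y \<in> carrier W" for x y
  proof -
    have "x \<oplus>\<^bsub>W\<^esub> y \<ominus>\<^bsub>W\<^esub> x \<ominus>\<^bsub>W\<^esub> y = (x \<oplus>\<^bsub>W\<^esub> \<ominus>\<^bsub>W\<^esub> x) \<oplus>\<^bsub>W\<^esub> (y \<oplus>\<^bsub>W\<^esub> \<ominus>\<^bsub>W\<^esub> y)"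
      using that by (simp only: W.M.minus_eq W.M.a_ac W.M.a_closed W.M.a_inv_closed)
    then show ?thesis using that by (simp add: W.M.r_neg)
  qed
  show ?thesis
    using M W p
  proof (induction rule: tensor_kernel_induct)
    case zero
    show ?case by (rule W.M.frag_sum_0)
  next
    case (rel p)
    then show ?case
    proof (cases rule: tensor_relatorsE)
      case (1 m n w)
      then show ?thesis by (simp add: M' diff of keys keysd W.smult_l_distr canc)
    next
      case (2 m w u)
      then show ?thesis by (simp add: M' diff of keys keysd W.smult_r_distr canc)
    next
      case (3 r m w)
      then show ?thesis
        by (simp add: M' diff of keys keysd W.smult_assoc1 W.M.r_neg W.M.minus_eq)
    qed
  next
    case (diff p q)
    then show ?case
      using W.M.frag_sum_diff[OF tensor_kernel_keys[OF M W diff(1)] tensor_kernel_keys[OF M W diff(2)], of ?b] b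
      by (simp add: M' W.M.minus_eq)
  qed
qed

text \<open>The injectivity of \<open>\<alpha>\<close> at $M = R$.\<close>

lemma inj_on_chi_of_alpha:
  assumes alpha: "left_alpha_pairing R P"
  shows "inj_on (chi P) (carrier (lmod P))"
proof (rule inj_onI)
  fix w u assume w: "w \<in> carrier (lmod P)" and u: "u \<in> carrier (lmod P)" and eq: "chi P w = chi P u"
  have P: "left_pairing R P" using alpha unfolding left_alpha_pairing_def by blast
  have W: "left_module R (lmod P)" using P unfolding left_pairing_def by blast
  interpret W: left_module R "lmod P" by fact
  let ?M = "regular_right_module R"
  have M: "right_module R ?M" by (rule right_module_regular[OF W.R.ring_axioms])
  interpret M: right_module R ?M by fact
  have M': "carrier ?M = carrier R" by (simp add: regular_right_module_def)
  \<comment> \<open>The tensor 1 \<otimes> w - 1 \<otimes> u is killed by \<alpha> because w and u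
    pair equally with V. Once it is known to be zero, multiplication R \<otimes> W \<rightarrow> W
    turns it into w - u = 0.\<close>
  let ?p = "frag_of (\<one>\<^bsub>R\<^esub>, w) - frag_of (\<one>\<^bsub>R\<^esub>, u)"
  have k: "kappa P v w = kappa P v u" if "v \<in> carrier (rmod P)" for v
    using fun_cong[OF eq, of v] that by (simp add: chi_def)
  let ?S = "carrier R \<times> carrier (lmod P)"
  have keys: "Poly_Mapping.keys (frag_of (\<one>\<^bsub>R\<^esub>, w)) \<subseteq> ?S" "Poly_Mapping.keys (frag_of (\<one>\<^bsub>R\<^esub>, u)) \<subseteq> ?S"
    using w u by (simp_all add: keys_frag_of)
  have "frag_sum ?M (\<lambda>(m, w). kappa P v w \<odot>\<^bsub>?M\<^esub> m) ?p = \<zero>\<^bsub>?M\<^esub>" if v: "v \<in> carrier (rmod P)" for v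
  proof -
    have b: "(case x of (m, w) \<Rightarrow> kappa P v w \<odot>\<^bsub>?M\<^esub> m) \<in> carrier ?M" if "x \<in> ?S" for x
      using that left_pairing_facts(1)[OF P v] M.smult_closed M' by auto
    show ?thesis
      using M.M.frag_sum_diff[OF keys b] b[of "(\<one>\<^bsub>R\<^esub>, w)"] b[of "(\<one>\<^bsub>R\<^esub>, u)"] w u k[OF v]
      by (simp add: M.M.frag_sum_of M.M.minus_eq M.M.r_neg)
  qed
  moreover have "Poly_Mapping.keys ?p \<subseteq> carrier ?M \<times> carrier (lmod P)"
    using keys keys_diff[of "frag_of (\<one>\<^bsub>R\<^esub>, w)" "frag_of (\<one>\<^bsub>R\<^esub>, u)"] M' by blast
  ultimately have "?p \<in> tensor_kernel R ?M (lmod P)"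
    using left_alpha_pairingD[OF alpha M] unfolding inj_on_alpha_map_iff[OF P M] by blast
  from frag_sum_regular_tensor_kernel[OF W this]
  have "w \<ominus>\<^bsub>lmod P\<^esub> u = \<zero>\<^bsub>lmod P\<^esub>"
    using W.M.frag_sum_diff[OF keys, of "\<lambda>(r, w). r \<odot>\<^bsub>lmod P\<^esub> w"] w u
    by (auto simp: W.M.frag_sum_of)
  then show "w = u" using w u W.M.minus_equality[of w "\<ominus>\<^bsub>lmod P\<^esub> u"] by (simp add: W.M.minus_eq)
qed

section \<open>Cogenerators, linear forms on R^n and density\<close>

text \<open>Faithfulness of Hom(-, E) is applied to two maps R \<rightarrow> B, namely r \<mapsto> c
  r and 0. They differ at 1, so some h separates c r from 0 for some r, and h(c) r \<noteq> 0 forces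
  h(c) \<noteq> 0.\<close>

lemma cogenerator_separates:
  fixes B :: "('a, 'a test) module"
  assumes E: "cogenerator_right_module R E" and B: "right_module R B"
    and c: "c \<in> carrier B" "c \<noteq> \<zero>\<^bsub>B\<^esub>"
  obtains h where "h \<in> lin_maps R B E" "h c \<noteq> \<zero>\<^bsub>E\<^esub>"
proof -
  interpret B: right_module R B by fact
  interpret E: right_module R E using E unfolding cogenerator_right_module_def by blast
  let ?M = "regular_right_module R"
  \<comment> \<open>The definition tests modules on \<open>'a test\<close> only, so the regular
    module is copied there, encoding a as the singleton of the constant sequence a.\<close>
  have inj: "inj_on (\<lambda>a. {\<lambda>_. a} :: 'a test) (carrier ?M)"
    by (auto simp: inj_on_def fun_eq_iff)
  from right_module_transport[OF right_module_regular[OF B.R.ring_axioms] inj]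
  obtain A :: "('a, 'a test) module" and psi where A: "right_module R A"
    and phi: "(\<lambda>a. {\<lambda>_. a}) \<in> lin_maps R ?M A" and psi: "psi \<in> lin_maps R A ?M"
    and inv: "\<And>x. x \<in> carrier ?M \<Longrightarrow> psi {\<lambda>_. x} = x" by blast
  have mult: "(\<lambda>r. r \<odot>\<^bsub>B\<^esub> c) \<in> lin_maps R ?M B"
    using c(1) by (auto simp: lin_maps_def regular_right_module_def B.smult_l_distr B.smult_assoc1)
  have f: "(\<lambda>r. r \<odot>\<^bsub>B\<^esub> c) \<circ> psi \<in> lin_maps R A B" using psi mult by (rule lin_maps_compose)
  have g: "(\<lambda>_. \<zero>\<^bsub>B\<^esub>) \<in> lin_maps R A B"
    unfolding lin_maps_def by (auto simp: B.smult_r_null)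
  have "{\<lambda>_. \<one>\<^bsub>R\<^esub>} \<in> carrier A"
    using lin_maps_closed[OF phi, of "\<one>\<^bsub>R\<^esub>"] by (simp add: regular_right_module_def)
  moreover have "((\<lambda>r. r \<odot>\<^bsub>B\<^esub> c) \<circ> psi) {\<lambda>_. \<one>\<^bsub>R\<^esub>} \<noteq> \<zero>\<^bsub>B\<^esub>"
    using inv[of "\<one>\<^bsub>R\<^esub>"] c by (simp add: regular_right_module_def)
  ultimately have "\<exists>h\<in>lin_maps R B E. \<exists>a\<in>carrier A. h (((\<lambda>r. r \<odot>\<^bsub>B\<^esub> c) \<circ> psi) a) \<noteq> h \<zero>\<^bsub>B\<^esub>"
    using E[unfolded cogenerator_right_module_def, THEN conjunct2, rule_format, OF f g] A B by blast
  then obtain h a where h: "h \<in> lin_maps R B E" and a: "a \<in> carrier A"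
    and ne: "h (psi a \<odot>\<^bsub>B\<^esub> c) \<noteq> h \<zero>\<^bsub>B\<^esub>" by auto
  have pa: "psi a \<in> carrier R" using lin_maps_closed[OF psi a] by (simp add: regular_right_module_def)
  have hs: "h (r \<odot>\<^bsub>B\<^esub> x) = r \<odot>\<^bsub>E\<^esub> h x" if "r \<in> carrier R" "x \<in> carrier B" for r x
    using h that unfolding lin_maps_def by blast
  have "h \<zero>\<^bsub>B\<^esub> = \<zero>\<^bsub>E\<^esub>" by (rule right_lin_maps_zero[OF B E.right_module_axioms h])
  then have "h c \<noteq> \<zero>\<^bsub>E\<^esub>" using ne hs[OF pa c(1)] pa by (auto simp: E.smult_r_null)
  with h show ?thesis by (rule that)
qed

text \<open>The module R^n. Tuples are functions on \<open>nat\<close>, so the cosets in a quotient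
  of R^n have type \<open>'a test\<close>, and the cogenerator hypothesis applies to such quotients
  directly.\<close>

definition free_right_module :: "('a, 'k) ring_scheme \<Rightarrow> nat \<Rightarrow> ('a, nat \<Rightarrow> 'a) module" where
  "free_right_module R n = \<lparr>carrier = {..<n} \<rightarrow>\<^sub>E carrier R, monoid.mult = undefined,
     monoid.one = undefined, ring.zero = (\<lambda>i\<in>{..<n}. \<zero>\<^bsub>R\<^esub>),
     ring.add = (\<lambda>x y. \<lambda>i\<in>{..<n}. x i \<oplus>\<^bsub>R\<^esub> y i), smult = (\<lambda>r x. \<lambda>i\<in>{..<n}. x i \<otimes>\<^bsub>R\<^esub> r)\<rparr>"

lemma right_module_free:
  assumes "ring R"
  shows "right_module R (free_right_module R n)"
proof -
  interpret R: ring R by fact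
  let ?M = "free_right_module R n"
  have ext: "x = y" if "x \<in> carrier ?M" "y \<in> carrier ?M" "\<And>i. i < n \<Longrightarrow> x i = y i" for x y
    by (rule PiE_ext[of _ "{..<n}" "\<lambda>_. carrier R"]) (use that in \<open>auto simp: free_right_module_def\<close>)
  have cl: "x i \<in> carrier R" if "x \<in> carrier ?M" "i < n" for x i
    using that by (auto simp: free_right_module_def)
  have add: "(x \<oplus>\<^bsub>?M\<^esub> y) i = x i \<oplus>\<^bsub>R\<^esub> y i" if "i < n" for x y i
    using that by (simp add: free_right_module_def)
  have smult: "(r \<odot>\<^bsub>?M\<^esub> x) i = x i \<otimes>\<^bsub>R\<^esub> r" if "i < n" for r x i
    using that by (simp add: free_right_module_def)
  have zero: "\<zero>\<^bsub>?M\<^esub> i = \<zero>\<^bsub>R\<^esub>" if "i < n" for i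
    using that by (simp add: free_right_module_def)
  have add_closed: "x \<oplus>\<^bsub>?M\<^esub> y \<in> carrier ?M" if "x \<in> carrier ?M" "y \<in> carrier ?M" for x y
    using that by (auto simp: free_right_module_def)
  have smult_closed: "r \<odot>\<^bsub>?M\<^esub> x \<in> carrier ?M" if "r \<in> carrier R" "x \<in> carrier ?M" for r x
    using that by (auto simp: free_right_module_def)
  have zero_closed: "\<zero>\<^bsub>?M\<^esub> \<in> carrier ?M" by (auto simp: free_right_module_def)
  have "abelian_group ?M"
  proof (rule abelian_groupI)
    fix x assume x: "x \<in> carrier ?M"
    show "\<exists>y\<in>carrier ?M. y \<oplus>\<^bsub>?M\<^esub> x = \<zero>\<^bsub>?M\<^esub>"
    proof
      let ?y = "(\<ominus>\<^bsub>R\<^esub> \<one>\<^bsub>R\<^esub>) \<odot>\<^bsub>?M\<^esub> x"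
      show y: "?y \<in> carrier ?M" by (rule smult_closed) (auto simp: x)
      show "?y \<oplus>\<^bsub>?M\<^esub> x = \<zero>\<^bsub>?M\<^esub>"
        by (rule ext[OF add_closed[OF y x] zero_closed])
          (simp add: add smult zero cl[OF x] R.r_minus R.l_neg)
    qed
  qed (auto intro!: add_closed zero_closed ext simp: add zero cl R.a_ac)
  then show ?thesis
    by (intro right_module.intro right_module_axioms.intro R.ring_axioms)
      (auto intro!: add_closed smult_closed ext
        simp: add smult cl R.l_distr R.r_distr R.m_assoc R.ring_axioms)
qed

text \<open>A linear form \<open>h\<close> on $R^n$ is $x \mapsto \sum_i a_i x_i$ with $a_i = h(e_i)$, and
  \<open>u\<close> is $\sum_i a_i w_i$; the partial sums are built up by induction.\<close>

lemma linear_form_of_dual: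
  assumes W: "left_module R W" and w: "\<And>i. i < n \<Longrightarrow> w i \<in> carrier W"
    and h: "h \<in> lin_maps R (free_right_module R n) (regular_right_module R)"
  shows "\<exists>u\<in>carrier W. \<forall>f\<in>carrier (left_dual R W). h (\<lambda>i\<in>{..<n}. f (w i)) = f u"
proof -
  interpret W: left_module R W by fact
  let ?M = "free_right_module R n"
  interpret M: right_module R ?M by (rule right_module_free[OF W.R.ring_axioms])
  have hc: "h x \<in> carrier R" if "x \<in> carrier ?M" for x
    using lin_maps_closed[OF h that] by (simp add: regular_right_module_def)
  have ha: "h (x \<oplus>\<^bsub>?M\<^esub> y) = h x \<oplus>\<^bsub>R\<^esub> h y" if "x \<in> carrier ?M" "y \<in> carrier ?M" for x y
    using h that by (simp add: lin_maps_def regular_right_module_def)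
  have hs: "h (r \<odot>\<^bsub>?M\<^esub> x) = h x \<otimes>\<^bsub>R\<^esub> r" if "r \<in> carrier R" "x \<in> carrier ?M" for r x
    using h that by (simp add: lin_maps_def regular_right_module_def)
  have D: "f x \<in> carrier R" "f (x \<oplus>\<^bsub>W\<^esub> y) = f x \<oplus>\<^bsub>R\<^esub> f y" "f (r \<odot>\<^bsub>W\<^esub> x) = r \<otimes>\<^bsub>R\<^esub> f x"
    if "f \<in> carrier (left_dual R W)" "x \<in> carrier W" "y \<in> carrier W" "r \<in> carrier R" for f x y r
    using that by (auto simp: left_dual_def lin_maps_def regular_left_module_def)
  \<comment> \<open>The tuple is truncated to its first k entries and padded with zeros, so that k =
    0 gives u = 0 and k = n gives the claim.\<close>
  have "k \<le> n \<Longrightarrow> \<exists>u\<in>carrier W. \<forall>f\<in>carrier (left_dual R W).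
      h (\<lambda>i\<in>{..<n}. if i < k then f (w i) else \<zero>\<^bsub>R\<^esub>) = f u" for k
  proof (induction k)
    case 0
    have "h (\<lambda>i\<in>{..<n}. \<zero>\<^bsub>R\<^esub>) = \<zero>\<^bsub>R\<^esub>"
      using right_lin_maps_zero[OF M.right_module_axioms right_module_regular[OF W.R.ring_axioms] h]
      by (simp add: free_right_module_def regular_right_module_def)
    moreover note left_dual_zero[OF W]
    moreover have "(\<lambda>i\<in>{..<n}. if i < 0 then f (w i) else \<zero>\<^bsub>R\<^esub>) = (\<lambda>i\<in>{..<n}. \<zero>\<^bsub>R\<^esub>)" for f
      by (rule restrict_ext) simp
    ultimately show ?case by (metis W.M.zero_closed)
  next
    case (Suc k)
    then obtain u where u: "u \<in> carrier W" "\<And>f. f \<in> carrier (left_dual R W) \<Longrightarrow>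
      h (\<lambda>i\<in>{..<n}. if i < k then f (w i) else \<zero>\<^bsub>R\<^esub>) = f u" by (meson Suc_leD)
    \<comment> \<open>The k-th basis vector. The new entry contributes e f(w_k), and h(e f(w_k)) =
      h(e) f(w_k) = f(h(e) w_k), so the witness grows by h(e) w_k.\<close>
    define e where "e = (\<lambda>i\<in>{..<n}. if i = k then \<one>\<^bsub>R\<^esub> else \<zero>\<^bsub>R\<^esub>)"
    have e: "e \<in> carrier ?M" unfolding e_def free_right_module_def by auto
    have wk: "w k \<in> carrier W" using w Suc by simp
    have "h (\<lambda>i\<in>{..<n}. if i < Suc k then f (w i) else \<zero>\<^bsub>R\<^esub>) = f (u \<oplus>\<^bsub>W\<^esub> h e \<odot>\<^bsub>W\<^esub> w k)"
      if f: "f \<in> carrier (left_dual R W)" for f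
    proof -
      let ?x = "\<lambda>i\<in>{..<n}. if i < k then f (w i) else \<zero>\<^bsub>R\<^esub>"
      have fw: "f (w i) \<in> carrier R" if "i < n" for i using D(1)[OF f w w] that W.R.zero_closed by blast
      have x: "?x \<in> carrier ?M" unfolding free_right_module_def using fw by auto
      have "(\<lambda>i\<in>{..<n}. if i < Suc k then f (w i) else \<zero>\<^bsub>R\<^esub>) = ?x \<oplus>\<^bsub>?M\<^esub> f (w k) \<odot>\<^bsub>?M\<^esub> e"
        using fw Suc.prems by (auto simp: free_right_module_def e_def fun_eq_iff less_Suc_eq)
      then show ?thesis
        using x e fw[of k] Suc.prems u wk hc[OF e] f D[OF f] by (simp add: ha hs)
    qed
    moreover have "u \<oplus>\<^bsub>W\<^esub> h e \<odot>\<^bsub>W\<^esub> w k \<in> carrier W" using u(1) wk hc[OF e] by simp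
    ultimately show ?case by blast
  qed
  note partial = this[OF order_refl]
  have "(\<lambda>i\<in>{..<n}. if i < n then f (w i) else \<zero>\<^bsub>R\<^esub>) = (\<lambda>i\<in>{..<n}. f (w i))" for f
    by (rule restrict_ext) simp
  with partial show ?thesis by (simp only:)
qed

text \<open>If the values $(f(w_i))_i$ of a functional were not of the form $(\langle v, w_i\rangle)_i$,
  a linear form on $R^n$ would kill all the latter but not the former.\<close>

lemma dense_pairing_of_inj_chi:
  fixes P :: "('a, 'b, 'c) pairing"
  assumes P: "left_pairing R P" and inj: "inj_on (chi P) (carrier (lmod P))"
    and E: "cogenerator_right_module R (regular_right_module R)"
  shows "dense_pairing R P"
  unfolding dense_pairing_iff[OF P]
proof (intro ballI allI impI)
  fix f F assume f: "f \<in> carrier (left_dual R (lmod P))" and "finite F \<and> F \<subseteq> carrier (lmod P)"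
  then obtain n and w :: "nat \<Rightarrow> _" where F: "F = w ` {i. i < n}"
    by (metis finite_conv_nat_seg_image)
  then have w: "w i \<in> carrier (lmod P)" if "i < n" for i
    using that \<open>finite F \<and> F \<subseteq> carrier (lmod P)\<close> by auto
  have V: "right_module R (rmod P)" and W: "left_module R (lmod P)"
    using P unfolding left_pairing_def by blast+
  interpret V: right_module R "rmod P" by fact
  interpret W: left_module R "lmod P" by fact
  let ?M = "free_right_module R n"
  have M: "right_module R ?M" by (rule right_module_free[OF V.R.ring_axioms])
  interpret M: right_module R ?M by fact
  note k = left_pairing_facts[OF P]
  have dual: "kappa P v \<in> carrier (left_dual R (lmod P))" if "v \<in> carrier (rmod P)" for v
    using P that unfolding left_pairing_def lin_maps_def by auto
  define ev :: "('c \<Rightarrow> 'a) \<Rightarrow> nat \<Rightarrow> 'a" where "ev = (\<lambda>g. \<lambda>i\<in>{..<n}. g (w i))"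
  have ev: "ev g \<in> carrier ?M" if "g \<in> carrier (left_dual R (lmod P))" for g
    using that w unfolding ev_def
    by (auto simp: free_right_module_def left_dual_def lin_maps_def regular_left_module_def)
  \<comment> \<open>The tuples of values on w_0, ..., w_(n-1) attained by elements of V; the goal is
    that the tuple of f is among them.\<close>
  define X where "X = (\<lambda>v. ev (kappa P v)) ` carrier (rmod P)"
  have X: "submodule X R ?M"
  proof (rule M.submoduleI)
    show "X \<subseteq> carrier ?M" unfolding X_def using ev dual by blast
    \<comment> \<open>Writing the zero of V as 0 times itself makes its values visibly 0; the
      deleted simplification rules would collapse that product.\<close>
    have "\<zero>\<^bsub>?M\<^esub> = ev (kappa P (\<zero>\<^bsub>R\<^esub> \<odot>\<^bsub>rmod P\<^esub> \<zero>\<^bsub>rmod P\<^esub>))"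
      using w k unfolding ev_def
      by (auto simp: free_right_module_def fun_eq_iff simp del: V.smult_l_null V.smult_r_null)
    then show "\<zero>\<^bsub>?M\<^esub> \<in> X" unfolding X_def by blast
  next
    fix x y assume "x \<in> X" "y \<in> X"
    then obtain v v' where v: "v \<in> carrier (rmod P)" "x = ev (kappa P v)"
      "v' \<in> carrier (rmod P)" "y = ev (kappa P v')" unfolding X_def by blast
    then have "x \<oplus>\<^bsub>?M\<^esub> y = ev (kappa P (v \<oplus>\<^bsub>rmod P\<^esub> v'))"
      using w k unfolding ev_def by (auto simp: free_right_module_def fun_eq_iff)
    then show "x \<oplus>\<^bsub>?M\<^esub> y \<in> X" unfolding X_def using v by blast
  next
    fix a x assume a: "a \<in> carrier R" and "x \<in> X"
    then obtain v where v: "v \<in> carrier (rmod P)" "x = ev (kappa P v)" unfolding X_def by blast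
    then have "a \<odot>\<^bsub>?M\<^esub> x = ev (kappa P (a \<odot>\<^bsub>rmod P\<^esub> v))"
      using w k a unfolding ev_def by (auto simp: free_right_module_def fun_eq_iff)
    then show "a \<odot>\<^bsub>?M\<^esub> x \<in> X" unfolding X_def using v a by blast
  qed
  interpret X: abelian_subgroup X ?M by (rule submodule_abelian_subgroup[OF M X])
  have "ev f \<in> X"
  proof (rule ccontr)
    let ?B = "quot_module ?M X"
    have B0: "\<zero>\<^bsub>?B\<^esub> = X" by (simp add: quot_module_def)
    assume "ev f \<notin> X"
    then have "X +>\<^bsub>?M\<^esub> ev f \<noteq> \<zero>\<^bsub>?B\<^esub>" using X.a_rcos_self[OF ev[OF f]] B0 by auto
    moreover have "X +>\<^bsub>?M\<^esub> ev f \<in> carrier ?B" using ev[OF f] by (simp add: quot_carrier)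
    \<comment> \<open>In R^n / X the class of the tuple of f is nonzero, so a linear form on the
      quotient is nonzero there. Composed with the projection, it becomes a form on R^n vanishing on
      X.\<close>
    ultimately obtain h where h: "h \<in> lin_maps R ?B (regular_right_module R)"
      and ne: "h (X +>\<^bsub>?M\<^esub> ev f) \<noteq> \<zero>\<^bsub>R\<^esub>"
      using cogenerator_separates[OF E right_module_quot[OF M X]]
      by (metis (no_types, lifting) regular_right_module_def ring.simps(1))
    let ?h = "h \<circ> (\<lambda>x. X +>\<^bsub>?M\<^esub> x)"
    have "?h \<in> lin_maps R ?M (regular_right_module R)"
      by (rule lin_maps_compose[OF quot_proj_lin_maps[OF M X] h])
    \<comment> \<open>On tuples of values of functionals, the form is evaluation at a single u in
      W.\<close>
    then have "\<exists>u\<in>carrier (lmod P). \<forall>g\<in>carrier (left_dual R (lmod P)). ?h (ev g) = g u"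
      unfolding ev_def using linear_form_of_dual[of R "lmod P" n w ?h] W w by blast
    then obtain u where u: "u \<in> carrier (lmod P)"
      and hu: "\<And>g. g \<in> carrier (left_dual R (lmod P)) \<Longrightarrow> ?h (ev g) = g u" by blast
    have h0: "h X = \<zero>\<^bsub>R\<^esub>"
      using right_lin_maps_zero[OF right_module_quot[OF M X] right_module_regular[OF V.R.ring_axioms] h] B0
      by (simp add: regular_right_module_def)
    \<comment> \<open>Tuples coming from V lie in X, which is the zero of the quotient, so u pairs
      to 0 with all of V. Injectivity of \<chi> then gives u = 0, although f(u) is the nonzero value
      of h.\<close>
    have "kappa P v u = kappa P v \<zero>\<^bsub>lmod P\<^esub>" if v: "v \<in> carrier (rmod P)" for v
    proof -
      have "ev (kappa P v) \<in> X" unfolding X_def using v by blast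
      then have "X +>\<^bsub>?M\<^esub> ev (kappa P v) = X" by (rule X.a_rcos_const)
      then show ?thesis using hu[OF dual[OF v]] h0 left_dual_zero[OF W dual[OF v]] by simp
    qed
    then have "chi P u = chi P \<zero>\<^bsub>lmod P\<^esub>" unfolding chi_def by (rule restrict_ext)
    then have "u = \<zero>\<^bsub>lmod P\<^esub>" using inj u by (simp add: inj_on_def)
    then show False using ne hu[OF f] left_dual_zero[OF W f] by simp
  qed
  then obtain v where v: "v \<in> carrier (rmod P)" "ev f = ev (kappa P v)" unfolding X_def by blast
  have "kappa P v (w i) = f (w i)" if "i < n" for i
    using fun_cong[OF v(2), of i] that unfolding ev_def by simp
  then show "\<exists>v\<in>carrier (rmod P). \<forall>w\<in>F. kappa P v w = f w" using v(1) F by auto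
qed

section \<open>Assembly of the equivalences\<close>

theorem proposition2p4:
  fixes R :: "('a, 'k) ring_scheme" (structure)
    and P :: "('a, 'v, 'w) pairing"
    and Om :: "('a, 'y, 'u) pairing"
    and V :: "('a, 'x) module"
    and xi :: "'x \<Rightarrow> 'y"
  assumes "ring R" and "\<one> \<noteq> \<zero>"
  shows
    "(left_pairing R P \<longrightarrow>
       (\<forall>W'. submodule W' R (lmod P) \<longrightarrow>
          (left_alpha_pairing R (restrict_pairing P W') \<longrightarrow> pure_submodule W' R (lmod P)) \<and>
          (left_alpha_pairing R P \<longrightarrow>
             (left_alpha_pairing R (restrict_pairing P W') \<longleftrightarrow> pure_submodule W' R (lmod P)))) \<and>
       (\<forall>V' W'. submodule V' R (rmod P) \<and> submodule W' R (lmod P) \<and>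
             pairing_annihilates R P V' W' \<longrightarrow>
          left_alpha_pairing R P \<longrightarrow>
             (left_alpha_pairing R (subpairing P V' W') \<longleftrightarrow> pure_submodule W' R (lmod P))) \<and>
       (\<forall>Q. left_alpha_pairing R P \<and> pure_left_subpairing R Q P \<longrightarrow> left_alpha_pairing R Q)) \<and>
     (left_pairing R Om \<and> right_module R V \<and> xi \<in> lin_maps R V (rmod Om) \<longrightarrow>
       (let P2 = pullback_pairing Om V xi;
            st1 = left_alpha_pairing R Om \<and> dense_pairing R P2;
            st2 = left_alpha_pairing R Om \<and>
                  linear_weak_topology R Om closure_of (xi ` carrier V) = carrier (rmod Om);
            st3 = left_alpha_pairing R P2;
            st4 = left_alpha_pairing R P2 \<and> inj_on (chi P2) (carrier (lmod P2))
        in (st1 \<longrightarrow> st2) \<and> (st2 \<longrightarrow> st3) \<and> (st3 \<longrightarrow> st4) \<and>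
           (injective_right_module R (regular_right_module R) \<and>
            cogenerator_right_module R (regular_right_module R) \<longrightarrow>
              (st1 \<longleftrightarrow> st2) \<and> (st2 \<longleftrightarrow> st3) \<and> (st3 \<longleftrightarrow> st4))))"
proof -
  have 1: "left_alpha_pairing R (restrict_pairing P W') \<longleftrightarrow> pure_submodule W' R (lmod P)"
    if "left_alpha_pairing R P" "submodule W' R (lmod P)" for W'
    using that left_alpha_pairing_restrict pure_submodule_of_alpha
    unfolding left_alpha_pairing_def by metis
  have 2: "left_alpha_pairing R (subpairing P V' W') \<longleftrightarrow> pure_submodule W' R (lmod P)"
    if "left_alpha_pairing R P" "submodule V' R (rmod P)" "submodule W' R (lmod P)"
      "pairing_annihilates R P V' W'" for V' W'
    using left_alpha_pairing_subpairing_iff[OF _ that(2-4)] 1[OF that(1,3)] that(1)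
    unfolding left_alpha_pairing_def by blast
  have 3: "left_alpha_pairing R Q"
    if alpha: "left_alpha_pairing R P" and "pure_left_subpairing R Q P" for Q
  proof -
    from that(2) obtain V' W' where Q: "submodule V' R (rmod P)" "pure_submodule W' R (lmod P)"
      "pairing_annihilates R P V' W'" "Q = subpairing P V' W'"
      unfolding pure_left_subpairing_def by blast
    moreover from Q(2) have "submodule W' R (lmod P)" unfolding pure_submodule_def by blast
    ultimately show ?thesis using 2[OF alpha] by blast
  qed
  define P2 where "P2 = pullback_pairing Om V xi"
  define st1 where "st1 \<longleftrightarrow> left_alpha_pairing R Om \<and> dense_pairing R P2"
  define st2 where "st2 \<longleftrightarrow> left_alpha_pairing R Om \<and>
    linear_weak_topology R Om closure_of (xi ` carrier V) = carrier (rmod Om)"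
  define st3 where "st3 \<longleftrightarrow> left_alpha_pairing R P2"
  define st4 where "st4 \<longleftrightarrow> left_alpha_pairing R P2 \<and> inj_on (chi P2) (carrier (lmod P2))"
  \<comment> \<open>The implication from \<open>st4\<close> back to \<open>st1\<close> closes the
    cycle, which yields all equivalences.\<close>
  have "(st1 \<longrightarrow> st2) \<and> (st2 \<longrightarrow> st3) \<and> (st3 \<longrightarrow> st4) \<and>
      (cogenerator_right_module R (regular_right_module R) \<longrightarrow> st4 \<longrightarrow> st1)"
    if Om: "left_pairing R Om" and V: "right_module R V" and xi: "xi \<in> lin_maps R V (rmod Om)"
  proof -
    have P2: "left_pairing R P2"
      unfolding P2_def using Om V xi by (rule left_pairing_pullback)
    have sel: "rmod P2 = V" "lmod P2 = lmod Om" "\<And>v. kappa P2 v = kappa Om (xi v)"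
      unfolding P2_def pullback_pairing_def by simp_all
    have xic: "xi ` carrier V \<subseteq> carrier (rmod Om)" using lin_maps_closed[OF xi] by blast
    have Omk: "kappa Om y \<in> carrier (left_dual R (lmod Om))" if "y \<in> carrier (rmod Om)" for y
      using Om that unfolding left_pairing_def lin_maps_def by auto
    note dense = dense_pairing_iff[OF P2, unfolded sel]
    note closure = closure_of_linear_weak_topology_eq[OF Om xic]
    \<comment> \<open>Each \<open>kappa Om y\<close> lies in the dual of W, so density of
      \<open>P2\<close> matches it on any finite set by some \<open>kappa Om (xi v)\<close>.\<close>
    have "st2" if st1
      using that Omk unfolding st1_def st2_def dense closure by blast
    moreover have "st3" if st2
      unfolding st3_def
      by (rule left_alpha_pairing_approx[of R Om])
        (use that P2 in \<open>auto simp: st2_def closure sel\<close>)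
    moreover have "st4" if st3
      using that inj_on_chi_of_alpha unfolding st3_def st4_def by blast
    moreover have "st1" if cog: "cogenerator_right_module R (regular_right_module R)" and st4
    proof -
      \<comment> \<open>Each functional of \<open>P2\<close> at v is that of \<open>Om\<close> at
        \<open>xi v\<close>, so the functionals of \<open>P2\<close> are among those of
        \<open>Om\<close> and the property passes to the larger supply.\<close>
      have "left_alpha_pairing R Om"
        by (rule left_alpha_pairing_approx[of R P2])
          (use \<open>st4\<close> Om xic in \<open>auto simp: st4_def sel\<close>)
      then show ?thesis
        using dense_pairing_of_inj_chi[OF P2 _ cog] \<open>st4\<close> unfolding st1_def st4_def by blast
    qed
    ultimately show ?thesis by blast
  qed
  then show ?thesis
    using pure_submodule_of_alpha[of R P] 1 2 3
    unfolding Let_def st1_def st2_def st3_def st4_def P2_def by blast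
qed

end
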